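(* Let $f_0\in L^1\cap L^\infty(\mathbb{R}^{2d})$, $f_0\ge0$, be a probability density, and for each $N\ge1$ let $Z_0=\{z_{i,0}=(x_{i,0},v_{i,0})\}_{i=1}^N$ be random initial configurations, with $\mu^N_0=\frac1N\sum_{i=1}^N\delta_{z_{i,0}}$ and $d\mu_0=f_0\,dz$. Suppose: (i) $\displaystyle\int_{\mathbb R^{2d}}\bigl(|x|^q+|v|^q+e^{\alpha|v|}\bigr)f_0(z)\,dz<\infty$ for some $\alpha>0$ and some $q>2$; (ii) $z_{i,0}$, $i=1,\dots,N$, are independent random variables with common law $f_0$; (iii) $\mathbb{E}[W_1(\mu^N_0,\mu_0)]\le CN^{-\eta}$ for some $\eta>0$ and a constant $C$ independent of $N$. Let $\mu_t$ (with $d\mu_t=f(t,z)\,dz$) be the weak solution of the kinetic Cucker--Smale equation with initial datum $f_0$, and let $\mu^N_t$ be the empirical measure generated by the Cucker--Smale particle system with initial configuration $Z_0$. Then for every finite $T>0$ there exist positive constants $C_T$ and $\eta_T$, independent of $N$, such that $$\mathbb{E}\left[\sup_{0\le t\le T}W_1(\mu^N_t,\mu_t)\right]\le\frac{C_T}{N^{\eta_T}}.$$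
   Context: Notation: $z=(x,v)\in\mathbb{R}^d\times\mathbb{R}^d$, $dz=dx\,dv$; $|\cdot|$ is the Euclidean norm; $W_1$ is the 1-Wasserstein distance on $\mathbb{R}^{2d}$. Fix $\kappa>0$ and $\phi\in W^{1,\infty}([0,\infty))$ with $0\le\phi(r)\le\|\phi\|_{L^\infty}$. Cucker--Smale particle system: for $i=1,\dots,N$, $\dot x_i=v_i$, $\dot v_i=\frac{\kappa}{N}\sum_{j=1}^N\phi(|x_i-x_j|)(v_j-v_i)$, $(x_i,v_i)(0)=(x_{i,0},v_{i,0})$. Its empirical measure is $\mu^N_t=\frac1N\sum_{i=1}^N\delta_{(x_i(t),v_i(t))}$. Kinetic Cucker--Smale equation: $\partial_tf+\nabla_x\cdot(vf)+\nabla_v\cdot(L[f]f)=0$, $f|_{t=0}=f_0$, with $L[f](t,x,v)=-\kappa\int_{\mathbb{R}^{2d}}\phi(|x-x_*|)(v-v_* )f(t,x_*,v_* )\,dx_*dv_*$. "The weak solution" is the unique distributional solution (tested against compactly supported $C^1$ functions) in $\mathcal{C}([0,T);L^1(\mathbb{R}^{2d}))\cap L^\infty_+([0,T)\times\mathbb{R}^{2d})$ for every finite $T$, with $|z|^2f(t)\in L^1$; it conserves mass and satisfies $\mu_t=(\Phi^t)_\#\mu_0$ where $\Phi^t(z)=(X(t),V(t))$ is the characteristic flow $\dot X=V$, $\dot V=L[f](t,X,V)$, $(X,V)(0)=z$. *)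

theory Defs
  imports "HOL-Probability.Probability" "HOL-Probability.Essential_Supremum"
begin

subsection \<open>The 1-Wasserstein distance and empirical measures\<close>

definition couplings :: "'a measure \<Rightarrow> 'a measure \<Rightarrow> ('a \<times> 'a) measure set" where
  "couplings \<mu> \<nu> = {\<pi>. sets \<pi> = sets (\<mu> \<Otimes>\<^sub>M \<nu>) \<and> distr \<pi> \<mu> fst = \<mu> \<and> distr \<pi> \<nu> snd = \<nu>}"

definition W1 :: "'a::metric_space measure \<Rightarrow> 'a measure \<Rightarrow> ennreal" where
  "W1 \<mu> \<nu> = (INF \<pi>\<in>couplings \<mu> \<nu>. \<integral>\<^sup>+ p. ennreal (dist (fst p) (snd p)) \<partial>\<pi>)"

definition empirical :: "nat \<Rightarrow> (nat \<Rightarrow> 'a::topological_space) \<Rightarrow> 'a measure" where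
  "empirical N z = distr (uniform_count_measure {1..N}) borel z"

lemma sets_empirical [simp]: "sets (empirical N z) = sets borel"
  by (simp add: empirical_def)

lemma emeasure_empirical:
  assumes "N \<ge> 1" "A \<in> sets borel"
  shows "emeasure (empirical N z) A = ennreal (1 / real N) * (\<Sum>i=1..N. emeasure (return borel (z i)) A)"
proof -
  have "emeasure (empirical N z) A = emeasure (uniform_count_measure {1..N}) (z -` A \<inter> {1..N})"
    unfolding empirical_def using assms
    by (subst emeasure_distr) (auto simp: measurable_def space_uniform_count_measure sets_uniform_count_measure)
  also have "\<dots> = ennreal (real (card (z -` A \<inter> {1..N})) / real N)"
    by (subst emeasure_uniform_count_measure) auto
  also have "real (card (z -` A \<inter> {1..N})) = (\<Sum>i=1..N. indicator A (z i))"
  proof -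
    have "(\<Sum>i=1..N. indicator A (z i) :: real) = (\<Sum>i=1..N. if z i \<in> A then 1 else 0)"
      by (intro sum.cong) (auto simp: indicator_def)
    also have "\<dots> = real (card {i\<in>{1..N}. z i \<in> A})"
      by (subst sum.inter_filter[symmetric]) auto
    also have "{i\<in>{1..N}. z i \<in> A} = z -` A \<inter> {1..N}" by auto
    finally show ?thesis by simp
  qed
  also have "ennreal ((\<Sum>i=1..N. indicator A (z i)) / real N)
      = ennreal (1 / real N) * (\<Sum>i=1..N. ennreal (indicator A (z i)))"
    by (subst sum_ennreal) (auto simp: ennreal_mult[symmetric] sum_nonneg)
  also have "(\<Sum>i=1..N. ennreal (indicator A (z i))) = (\<Sum>i=1..N. emeasure (return borel (z i)) A)"
    using assms by (intro sum.cong) (auto simp: indicator_def)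
  finally show ?thesis .
qed

subsection \<open>Function spaces\<close>

definition Linf :: "'a measure \<Rightarrow> ('a \<Rightarrow> real) \<Rightarrow> bool" where
  "Linf M g \<longleftrightarrow> g \<in> borel_measurable M \<and> (\<exists>C. AE x in M. \<bar>g x\<bar> \<le> C)"

text \<open>\<open>C1c S \<psi> G\<close>: the function \<open>\<psi>\<close> is continuously differentiable with gradient \<open>G\<close>,
  and its support is a compact subset of \<open>S\<close>.\<close>

definition C1c :: "'a::euclidean_space set \<Rightarrow> ('a \<Rightarrow> real) \<Rightarrow> ('a \<Rightarrow> 'a) \<Rightarrow> bool" where
  "C1c S \<psi> G \<longleftrightarrow>
     continuous_on UNIV G \<and> (\<forall>p. (\<psi> has_derivative (\<lambda>h. G p \<bullet> h)) (at p)) \<and>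
     compact (closure {p. \<psi> p \<noteq> 0}) \<and> closure {p. \<psi> p \<noteq> 0} \<subseteq> S"

text \<open>Membership in \<open>W\<^sup>1\<^sup>,\<^sup>\<infinity>\<close> of the half line \<open>[0, \<infinity>)\<close>, with \<open>g\<close> the weak derivative.
  Since the kernel is evaluated pointwise, the function is taken to be the continuous
  representative of its class.\<close>

definition W1inf_half_line :: "(real \<Rightarrow> real) \<Rightarrow> bool" where
  "W1inf_half_line \<phi> \<longleftrightarrow>
     continuous_on {0..} \<phi> \<and> Linf (restrict_space lborel {0..}) \<phi> \<and>
     (\<exists>g. Linf (restrict_space lborel {0..}) g \<and>
       (\<forall>\<psi> \<psi>'. C1c {0<..} \<psi> \<psi>' \<longrightarrow>
          set_lebesgue_integral lborel {0..} (\<lambda>r. \<phi> r * \<psi>' r)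
            = - set_lebesgue_integral lborel {0..} (\<lambda>r. g r * \<psi> r)))"

subsection \<open>The Cucker--Smale particle system\<close>

definition CS_particles ::
    "real \<Rightarrow> (real \<Rightarrow> real) \<Rightarrow> nat \<Rightarrow> (nat \<Rightarrow> (real^'d) \<times> (real^'d))
     \<Rightarrow> (nat \<Rightarrow> real \<Rightarrow> real^'d) \<Rightarrow> (nat \<Rightarrow> real \<Rightarrow> real^'d) \<Rightarrow> bool" where
  "CS_particles \<kappa> \<phi> N z0 x v \<longleftrightarrow>
     (\<forall>i\<in>{1..N}. (x i 0, v i 0) = z0 i \<and>
       (\<forall>t\<ge>0. (x i has_vector_derivative v i t) (at t within {0..}) \<and>
         (v i has_vector_derivative
            (\<kappa> / real N) *\<^sub>R (\<Sum>j=1..N. \<phi> (norm (x i t - x j t)) *\<^sub>R (v j t - v i t)))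
           (at t within {0..})))"

subsection \<open>The kinetic Cucker--Smale equation\<close>

definition CS_force ::
    "real \<Rightarrow> (real \<Rightarrow> real) \<Rightarrow> ((real^'d) \<times> (real^'d) \<Rightarrow> real) \<Rightarrow> real^'d \<Rightarrow> real^'d \<Rightarrow> real^'d" where
  "CS_force \<kappa> \<phi> g x v =
     - \<kappa> *\<^sub>R (LINT w|lborel. (\<phi> (norm (x - fst w)) * g w) *\<^sub>R (v - snd w))"

text \<open>The integrand of the distributional formulation for a test function with gradient \<open>G\<close>;
  the three components of \<open>G\<close> are the time derivative and the gradients in \<open>x\<close> and \<open>v\<close>.\<close>

definition CS_weak_integrand ::
    "real \<Rightarrow> (real \<Rightarrow> real) \<Rightarrow> (real \<Rightarrow> (real^'d) \<times> (real^'d) \<Rightarrow> real)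
     \<Rightarrow> (real \<times> (real^'d) \<times> (real^'d) \<Rightarrow> real \<times> (real^'d) \<times> (real^'d))
     \<Rightarrow> real \<times> (real^'d) \<times> (real^'d) \<Rightarrow> real" where
  "CS_weak_integrand \<kappa> \<phi> f G = (\<lambda>(t, x, v).
     f t (x, v) * (fst (G (t, x, v)) + v \<bullet> fst (snd (G (t, x, v)))
                    + CS_force \<kappa> \<phi> (f t) x v \<bullet> snd (snd (G (t, x, v)))))"

definition CS_distributional ::
    "real \<Rightarrow> (real \<Rightarrow> real) \<Rightarrow> ((real^'d) \<times> (real^'d) \<Rightarrow> real) \<Rightarrow> real
     \<Rightarrow> (real \<Rightarrow> (real^'d) \<times> (real^'d) \<Rightarrow> real) \<Rightarrow> bool" where
  "CS_distributional \<kappa> \<phi> f0 T f \<longleftrightarrow>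
     (\<forall>\<psi> G. C1c ({..<T} \<times> UNIV) \<psi> G \<longrightarrow>
        set_integrable lborel ({0..<T} \<times> UNIV) (CS_weak_integrand \<kappa> \<phi> f G) \<and>
        set_lebesgue_integral lborel ({0..<T} \<times> UNIV) (CS_weak_integrand \<kappa> \<phi> f G)
          + (LINT z|lborel. f0 z * \<psi> (0, z)) = 0)"

text \<open>The class \<open>C([0,T); L\<^sup>1) \<inter> L\<^sup>\<infinity>\<^sub>+([0,T) \<times> \<real>\<^sup>2\<^sup>d)\<close> with finite second moments.\<close>

definition CS_solution_class :: "real \<Rightarrow> (real \<Rightarrow> (real^'d) \<times> (real^'d) \<Rightarrow> real) \<Rightarrow> bool" where
  "CS_solution_class T f \<longleftrightarrow>
     (\<forall>t\<in>{0..<T}. integrable lborel (f t)) \<and>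
     (\<forall>s\<in>{0..<T}. ((\<lambda>t. LINT z|lborel. \<bar>f t z - f s z\<bar>) \<longlongrightarrow> 0) (at s within {0..<T})) \<and>
     Linf (restrict_space lborel ({0..<T} \<times> UNIV)) (\<lambda>(t, z). f t z) \<and>
     (AE (t, z) in restrict_space lborel ({0..<T} \<times> UNIV). 0 \<le> f t z) \<and>
     (\<forall>t\<in>{0..<T}. integrable lborel (\<lambda>z. (norm z)\<^sup>2 * f t z))"

definition CS_flow ::
    "real \<Rightarrow> (real \<Rightarrow> real) \<Rightarrow> (real \<Rightarrow> (real^'d) \<times> (real^'d) \<Rightarrow> real)
     \<Rightarrow> (real \<Rightarrow> (real^'d) \<times> (real^'d) \<Rightarrow> (real^'d) \<times> (real^'d)) \<Rightarrow> bool" where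
  "CS_flow \<kappa> \<phi> f \<Phi> \<longleftrightarrow>
     (\<forall>z. \<Phi> 0 z = z \<and>
       (\<forall>t\<ge>0. ((\<lambda>s. \<Phi> s z) has_vector_derivative
          (snd (\<Phi> t z), CS_force \<kappa> \<phi> (f t) (fst (\<Phi> t z)) (snd (\<Phi> t z)))) (at t within {0..})))"

text \<open>The last two conjuncts are the known properties that the weak solution conserves mass
  and is transported by its characteristic flow.\<close>

definition CS_weak_solution ::
    "real \<Rightarrow> (real \<Rightarrow> real) \<Rightarrow> ((real^'d) \<times> (real^'d) \<Rightarrow> real)
     \<Rightarrow> (real \<Rightarrow> (real^'d) \<times> (real^'d) \<Rightarrow> real) \<Rightarrow> bool" where
  "CS_weak_solution \<kappa> \<phi> f0 f \<longleftrightarrow>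
     (AE z in lborel. f 0 z = f0 z) \<and>
     (\<forall>T>0. CS_solution_class T f \<and> CS_distributional \<kappa> \<phi> f0 T f) \<and>
     (\<forall>t\<ge>0. (LINT z|lborel. f t z) = (LINT z|lborel. f0 z)) \<and>
     (\<exists>\<Phi>. CS_flow \<kappa> \<phi> f \<Phi> \<and>
        (\<forall>t\<ge>0. \<Phi> t \<in> borel_measurable borel \<and>
           density lborel (\<lambda>z. ennreal (f t z))
             = distr (density lborel (\<lambda>z. ennreal (f0 z))) borel (\<Phi> t)))"

end

theory Submission
  imports Defs
begin

text \<open>Both the particle system and the kinetic equation are instances of one mean-field dynamics: a
  law \<open>\<mu>\<close> is transported by a flow whose velocity field is the alignment force of
  the transported law. For the particles, \<open>\<mu>\<close> is the empirical measure of the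
  initial configuration. If \<open>\<pi>\<close> couples two initial laws, the two flows carry
  \<open>\<pi>\<close> to a coupling at time \<open>t\<close>, so the Wasserstein distance at time
  \<open>t\<close> is at most the mean \<open>D t\<close> over \<open>\<pi>\<close> of the
  distance between the two trajectories.

  The obstacle is that the alignment force depends on position with a Lipschitz constant that is
  proportional to velocity, and velocities are unbounded. Splitting the velocities of one of the
  two systems at a level \<open>R\<close>, and paying for the tail with an exponential moment of
  order \<open>\<alpha>\<close>, gives a differential inequality of the form \<open>D' \<le> C (1
  + R) D + C exp (- \<alpha> R)\<close>, in which \<open>R\<close> may depend on time. Only the
  velocities of the kinetic solution are split, so no constant depends on the random
  configuration. A level \<open>R\<close> that is constant in time gives a rate only on a short
  interval, because the growth factor \<open>exp (C R t)\<close> eventually beats the gain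
  \<open>exp (- \<alpha> R)\<close>. The decreasing level \<open>R t = R0 exp (- \<lambda>
  t)\<close> with \<open>\<lambda>\<close> of order \<open>C / \<alpha>\<close> removes this
  restriction: the growth between \<open>s\<close> and \<open>t\<close> is then at most of order
  \<open>exp ((\<alpha> / 2) (R s - R t))\<close>, which half of the gain absorbs. The result,
  \<open>mean_field_stability\<close> and its Wasserstein form
  \<open>mean_field_flow_W1_stability\<close>, bounds \<open>D t\<close> by an affine function of
  \<open>D 0\<close>, with slope of order \<open>exp (\<alpha> R0 / 2)\<close> and constant term
  of order \<open>exp (- (\<alpha> / 2) R0 exp (- \<lambda> T))\<close>.

  Taking \<open>R0 = (\<eta> / \<alpha>) ln N\<close>, which is the same for all configurations,
  and then expectations, the slope \<open>N powr (\<eta> / 2)\<close> is beaten by the hypothesis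
  on the initial distance, while the constant term is \<open>N powr (- \<eta>_T)\<close> with
  \<open>\<eta>_T = (\<eta> / 2) exp (- \<lambda> T)\<close>. The inequality is affine, so the
  expectation passes through it even though the distances are not known to be measurable functions
  of the configuration: \<open>nn_integral_affine_le\<close> holds for the lower integral.

  What remains is to place the kinetic solution in this setting. Its first velocity moment is a
  priori finite at each time only; a Baire category argument
  (\<open>first_moment_bounded_on_interval\<close>) makes it bounded on \<open>{0..T}\<close>. Since
  alignment is dissipative, the norm of each velocity then exceeds its initial value by at most a
  constant, which propagates the exponential moment of the initial law with the same exponent.\<close>

section \<open>Comparison, increments and lower integrals\<close>

text \<open>This is Gronwall's inequality with an explicit supersolution \<open>y\<close>. The hypothesis is
  on \<open>w \<bullet> w'\<close> and not on the norm of \<open>w'\<close>, so that damping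
  terms, which point inwards, can be discarded.\<close>
lemma norm_le_by_comparison:
  fixes w w' :: "real \<Rightarrow> 'a::real_inner" and y y' b B g :: "real \<Rightarrow> real"
  assumes w: "\<And>s. s \<in> {0..T} \<Longrightarrow> (w has_vector_derivative w' s) (at s within {0..T})"
    and y: "\<And>s. s \<in> {0..T} \<Longrightarrow> (y has_real_derivative y' s) (at s within {0..T})"
    and B: "\<And>s. s \<in> {0..T} \<Longrightarrow> (B has_real_derivative b s) (at s within {0..T})"
    and sub: "\<And>s. s \<in> {0..T} \<Longrightarrow> w s \<bullet> w' s \<le> norm (w s) * (b s * norm (w s) + g s)"
    and super: "\<And>s. s \<in> {0..T} \<Longrightarrow> b s * y s + g s \<le> y' s"
    and b: "\<And>s. s \<in> {0..T} \<Longrightarrow> 0 \<le> b s" and g: "\<And>s. s \<in> {0..T} \<Longrightarrow> 0 \<le> g s"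
    and init: "norm (w 0) \<le> y 0" and t: "t \<in> {0..T}"
  shows "norm (w t) \<le> y t"
proof (rule field_le_epsilon)
  fix e :: real assume "e > 0"
  \<comment> \<open>The norm is not differentiable at the origin; \<open>n = sqrt (w \<bullet> w + d\<^sup>2)\<close> is smooth and exceeds it by at most
      \<open>d\<close>.\<close>
  define d where "d = e * exp (B 0 - B t)"
  have d: "d > 0" using \<open>e > 0\<close> by (simp add: d_def)
  define n where "n s = sqrt (w s \<bullet> w s + d\<^sup>2)" for s
  have npos: "n s > 0" for s
    using d by (simp add: n_def add_nonneg_pos)
  have wn: "norm (w s) \<le> n s" for s
    unfolding n_def norm_eq_sqrt_inner by (intro real_sqrt_le_mono) simp
  define F where "F s = exp (- B s) * (n s - y s)" for s
  have dn: "(n has_real_derivative (w s \<bullet> w' s) / n s) (at s within {0..T})" if "s \<in> {0..T}" for s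
  proof -
    have "((\<lambda>s. w s \<bullet> w s) has_vector_derivative (w s \<bullet> w' s + w' s \<bullet> w s)) (at s within {0..T})"
      by (intro bounded_bilinear.has_vector_derivative[OF bounded_bilinear_inner] w that)
    then have "((\<lambda>s. w s \<bullet> w s) has_real_derivative (2 * (w s \<bullet> w' s))) (at s within {0..T})"
      by (simp add: has_real_derivative_iff_has_vector_derivative inner_commute)
    then have "((\<lambda>s. w s \<bullet> w s + d\<^sup>2) has_real_derivative (2 * (w s \<bullet> w' s))) (at s within {0..T})"
      by (auto intro!: derivative_eq_intros)
    moreover have "w s \<bullet> w s + d\<^sup>2 > 0" using d by (simp add: add_nonneg_pos)
    ultimately have "((\<lambda>s. sqrt (w s \<bullet> w s + d\<^sup>2)) has_real_derivative
        (inverse (sqrt (w s \<bullet> w s + d\<^sup>2)) / 2 * (2 * (w s \<bullet> w' s)))) (at s within {0..T})"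
      by (intro DERIV_chain2[OF DERIV_real_sqrt])
    moreover have "inverse (n s) / 2 * (2 * (w s \<bullet> w' s)) = (w s \<bullet> w' s) / n s"
      by (simp add: field_simps)
    ultimately show ?thesis unfolding n_def by simp
  qed
  have dF: "(F has_real_derivative
      exp (- B s) * ((w s \<bullet> w' s) / n s - y' s - b s * (n s - y s))) (at s within {0..T})"
    if "s \<in> {0..T}" for s
    unfolding F_def using that
    by (auto intro!: derivative_eq_intros dn y B simp: algebra_simps)
  have neg: "exp (- B s) * ((w s \<bullet> w' s) / n s - y' s - b s * (n s - y s)) \<le> 0" if s: "s \<in> {0..T}" for s
  proof -
    have "w s \<bullet> w' s \<le> n s * (b s * n s + g s)"
      using sub[OF s] wn[of s] b[OF s] g[OF s] npos[of s]
      by (intro order_trans[OF sub[OF s]] mult_mono add_mono order_refl) auto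
    then have "(w s \<bullet> w' s) / n s \<le> b s * n s + g s"
      using npos[of s] by (simp add: field_simps)
    then have "(w s \<bullet> w' s) / n s - y' s - b s * (n s - y s) \<le> 0"
      using super[OF s] by (simp add: algebra_simps)
    then show ?thesis by (simp add: mult_nonneg_nonpos)
  qed
  have "F t \<le> F 0"
  proof (cases "t = 0")
    case False
    then have t0: "0 < t" "t \<le> T" using t by auto
    show ?thesis
    proof (rule DERIV_nonpos_imp_decreasing_open[OF less_imp_le[OF t0(1)]])
      fix s assume s: "0 < s" "s < t"
      then have "at s within {0..T} = at s" using t0 by (intro at_within_Icc_at) auto
      then show "\<exists>y. (F has_real_derivative y) (at s) \<and> y \<le> 0"
        using dF[of s] neg[of s] s t0 by auto
    next
      have "continuous_on {0..T} F"
        using dF by (meson DERIV_continuous continuous_on_eq_continuous_within)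
      then show "continuous_on {0..t} F" using t0 by (auto elim: continuous_on_subset)
    qed
  qed auto
  moreover have "n 0 \<le> norm (w 0) + d"
    unfolding n_def power2_norm_eq_inner[symmetric]
    using d by (intro real_le_lsqrt) (auto simp: power2_sum)
  then have "F 0 \<le> exp (- B 0) * d"
    using init by (simp add: F_def)
  ultimately have "exp (- B t) * (n t - y t) \<le> exp (- B 0) * d" unfolding F_def by linarith
  then have "exp (B t) * (exp (- B t) * (n t - y t)) \<le> exp (B t) * (exp (- B 0) * d)"
    by (intro mult_left_mono) auto
  also have "exp (B t) * (exp (- B t) * (n t - y t)) = n t - y t"
    by (simp add: exp_minus)
  also have "exp (B t) * (exp (- B 0) * d) = e"
    by (simp add: d_def exp_minus exp_diff field_simps)
  finally show "norm (w t) \<le> y t + e" using wn[of t] by simp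
qed

lemma norm_increment_le:
  fixes f :: "real \<Rightarrow> 'a::real_normed_vector"
  assumes der: "\<And>r. r \<in> {a..b} \<Longrightarrow> (f has_vector_derivative f' r) (at r within {a..b})"
    and bound: "\<And>r. r \<in> {a..b} \<Longrightarrow> norm (f' r) \<le> K"
    and st: "s \<in> {a..b}" "t \<in> {a..b}"
  shows "norm (f t - f s) \<le> K * \<bar>t - s\<bar>"
proof -
  have "norm (f t - f s) \<le> K * norm (t - s)"
  proof (rule differentiable_bound)
    show "convex {a..b}" by simp
    show "(f has_derivative (\<lambda>h. h *\<^sub>R f' r)) (at r within {a..b})" if "r \<in> {a..b}" for r
      using der[OF that] by (simp add: has_vector_derivative_def)
    show "onorm (\<lambda>h. h *\<^sub>R f' r) \<le> K" if "r \<in> {a..b}" for r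
      by (rule onorm_le) (use mult_right_mono[OF bound[OF that] abs_ge_zero] in \<open>simp add: mult.commute\<close>)
  qed (use st in auto)
  then show ?thesis by simp
qed

lemma ennreal_le_affine_iff:
  assumes A: "A > 0" and B: "B \<ge> 0"
  shows "s \<le> ennreal A * g + ennreal B \<longleftrightarrow> ennreal (1 / A) * (s - ennreal B) \<le> g"
proof -
  have inv: "ennreal A * ennreal (1 / A) = 1" "ennreal (1 / A) * ennreal A = 1"
    using A by (simp_all add: ennreal_mult[symmetric])
  have "s \<le> ennreal A * g + ennreal B \<longleftrightarrow> s - ennreal B \<le> ennreal A * g"
    by (simp add: ennreal_minus_le_iff add.commute)
  also have "\<dots> \<longleftrightarrow> ennreal (1 / A) * (s - ennreal B) \<le> g"
  proof
    assume "s - ennreal B \<le> ennreal A * g"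
    then have "ennreal (1 / A) * (s - ennreal B) \<le> ennreal (1 / A) * (ennreal A * g)"
      by (intro mult_left_mono) auto
    then show "ennreal (1 / A) * (s - ennreal B) \<le> g"
      unfolding mult.assoc[symmetric] inv by simp
  next
    assume "ennreal (1 / A) * (s - ennreal B) \<le> g"
    then have "ennreal A * (ennreal (1 / A) * (s - ennreal B)) \<le> ennreal A * g"
      by (intro mult_left_mono) auto
    then show "s - ennreal B \<le> ennreal A * g"
      unfolding mult.assoc[symmetric] inv by simp
  qed
  finally show ?thesis .
qed

text \<open>For a nonmeasurable \<open>g\<close> the integrals are lower integrals, which are not additive
  in general. A constant summand on a probability space can nevertheless be split off, because a
  simple function \<open>s\<close> below \<open>A g + B\<close> yields the measurable minorant
  \<open>(s - B) / A\<close> of \<open>g\<close>.\<close>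
lemma nn_integral_affine_le:
  fixes g :: "'a \<Rightarrow> ennreal" and A B :: real
  assumes "prob_space M" and A: "A > 0" and B: "B \<ge> 0"
  shows "(\<integral>\<^sup>+\<omega>. (ennreal A * g \<omega> + ennreal B) \<partial>M) \<le> ennreal A * (\<integral>\<^sup>+\<omega>. g \<omega> \<partial>M) + ennreal B"
proof -
  interpret prob_space M by fact
  show ?thesis
    unfolding nn_integral_def[of M "\<lambda>\<omega>. ennreal A * g \<omega> + ennreal B"]
  proof (rule SUP_least, clarify)
    fix s assume s: "simple_function M s" and le: "s \<le> (\<lambda>\<omega>. ennreal A * g \<omega> + ennreal B)"
    have sm[measurable]: "s \<in> borel_measurable M" by (rule borel_measurable_simple_function[OF s])
    define r where "r \<omega> = ennreal (1 / A) * (s \<omega> - ennreal B)" for \<omega>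
    have rm[measurable]: "r \<in> borel_measurable M" unfolding r_def[abs_def] by measurable
    have rg: "r \<omega> \<le> g \<omega>" for \<omega>
      using le ennreal_le_affine_iff[OF A B] by (auto simp: r_def le_fun_def)
    have sr: "s \<omega> \<le> ennreal A * r \<omega> + ennreal B" for \<omega>
      unfolding ennreal_le_affine_iff[OF A B] r_def by (rule order_refl)
    have "integral\<^sup>S M s = (\<integral>\<^sup>+\<omega>. s \<omega> \<partial>M)" by (rule nn_integral_eq_simple_integral[OF s, symmetric])
    also have "\<dots> \<le> (\<integral>\<^sup>+\<omega>. (ennreal A * r \<omega> + ennreal B) \<partial>M)" by (rule nn_integral_mono[OF sr])
    also have "\<dots> = ennreal A * (\<integral>\<^sup>+\<omega>. r \<omega> \<partial>M) + ennreal B"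
      by (simp add: nn_integral_add nn_integral_cmult emeasure_space_1)
    also have "\<dots> \<le> ennreal A * (\<integral>\<^sup>+\<omega>. g \<omega> \<partial>M) + ennreal B"
      by (intro add_mono mult_left_mono nn_integral_mono rg) auto
    finally show "integral\<^sup>S M s \<le> ennreal A * (\<integral>\<^sup>+\<omega>. g \<omega> \<partial>M) + ennreal B" .
  qed
qed

section \<open>The communication kernel is bounded and Lipschitz\<close>

text \<open>The pointwise bound \<open>\<phi> r \<le> esssup \<bar>\<phi>\<bar>\<close> holds for every
  \<open>r\<close>, which turns the almost-everywhere bound in \<open>Linf\<close> into a bound at
  every point.\<close>
lemma kernel_bounded_of_esssup_bound:
  assumes "Linf (restrict_space lborel {0..}) \<phi>"
    and bound: "\<forall>r\<ge>0. 0 \<le> \<phi> r \<and>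
           ereal (\<phi> r) \<le> esssup (restrict_space lborel {0..}) (\<lambda>s. ereal \<bar>\<phi> s\<bar>)"
  obtains K where "K \<ge> 1" "\<And>r. r \<ge> 0 \<Longrightarrow> 0 \<le> \<phi> r \<and> \<phi> r \<le> K"
proof -
  obtain C where m: "\<phi> \<in> borel_measurable (restrict_space lborel {0..})"
    and C: "AE x in restrict_space lborel {0..}. \<bar>\<phi> x\<bar> \<le> C"
    using assms(1) by (auto simp: Linf_def)
  have "esssup (restrict_space lborel {0..}) (\<lambda>s. ereal \<bar>\<phi> s\<bar>) \<le> ereal C"
    by (rule esssup_I) (use m C in auto)
  then have "\<phi> r \<le> C" if "r \<ge> 0" for r
    using bound that order_trans by fastforce
  then show ?thesis using bound by (intro that[of "max 1 C"]) (auto simp: max.coboundedI2)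
qed

text \<open>The continuously differentiable primitive of the positive part, from which the test functions
  are built.\<close>
definition pos_sq :: "real \<Rightarrow> real" where "pos_sq s = (max 0 s)\<^sup>2 / 2"

lemma pos_sq_deriv: "(pos_sq has_real_derivative max 0 s) (at s)"
proof -
  have r: "(pos_sq has_real_derivative max 0 s) (at s within {0..})" if "s \<ge> 0"
  proof -
    have "((\<lambda>s::real. s\<^sup>2 / 2) has_real_derivative s) (at s within {0..})"
      by (auto intro!: derivative_eq_intros)
    then have "(pos_sq has_real_derivative s) (at s within {0..})"
      by (rule has_field_derivative_transform_within[OF _ zero_less_one]) (use that in \<open>auto simp: pos_sq_def\<close>)
    then show ?thesis using that by simp
  qed
  have l: "(pos_sq has_real_derivative max 0 s) (at s within {..0})" if "s \<le> 0"
  proof -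
    have "((\<lambda>s::real. 0) has_real_derivative 0) (at s within {..0})" by simp
    then have "(pos_sq has_real_derivative 0) (at s within {..0})"
      by (rule has_field_derivative_transform_within[OF _ zero_less_one]) (use that in \<open>auto simp: pos_sq_def\<close>)
    then show ?thesis using that by simp
  qed
  show ?thesis
  proof (cases s "0::real" rule: linorder_cases)
    case less
    then have "at s within {..0} = at s" by (intro at_within_interior) auto
    then show ?thesis using less l by simp
  next
    case greater
    then have "at s within {0..} = at s" by (intro at_within_interior) auto
    then show ?thesis using greater r by simp
  next
    case equal
    have eq: "{0..} \<union> {..0::real} = UNIV" by auto
    have "(pos_sq has_real_derivative max 0 s) (at s within ({0..} \<union> {..0}))"
      using l r equal unfolding has_field_derivative_iff Lim_within_Un by blast
    then show ?thesis unfolding eq .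
  qed
qed

text \<open>The tent has integral 1 and \<open>ramp\<close> is its primitive. The difference of two ramps is
  therefore an admissible test function that approximates the indicator of an interval, and its
  derivative evaluates a continuous function approximately at the two end points.\<close>
definition tent :: "real \<Rightarrow> real \<Rightarrow> real \<Rightarrow> real" where
  "tent e a s = (max 0 (s - a + e) - 2 * max 0 (s - a) + max 0 (s - a - e)) / e\<^sup>2"

definition ramp :: "real \<Rightarrow> real \<Rightarrow> real \<Rightarrow> real" where
  "ramp e a s = (pos_sq (s - a + e) - 2 * pos_sq (s - a) + pos_sq (s - a - e)) / e\<^sup>2"

lemma ramp_deriv: "(ramp e a has_real_derivative tent e a s) (at s)"
proof -
  have "((\<lambda>s. pos_sq (s + c)) has_real_derivative max 0 (s + c)) (at s)" for c
    using DERIV_shift[of pos_sq "max 0 (s+c)" s c] pos_sq_deriv[of "s+c"] by simp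
  from this[of "e - a"] this[of "-a"] this[of "- a - e"]
  have 1: "((\<lambda>s. pos_sq (s - a + e)) has_real_derivative max 0 (s - a + e)) (at s)"
   "((\<lambda>s. pos_sq (s - a)) has_real_derivative max 0 (s - a)) (at s)"
   "((\<lambda>s. pos_sq (s - a - e)) has_real_derivative max 0 (s - a - e)) (at s)"
    by (simp_all add: algebra_simps)
  show ?thesis
    unfolding ramp_def tent_def
    by (intro DERIV_cdivide DERIV_add DERIV_diff 1 DERIV_cmult)
qed

lemma tent_nonneg: "e > 0 \<Longrightarrow> 0 \<le> tent e a s"
  unfolding tent_def by (intro divide_nonneg_nonneg) (auto simp: max_def)

lemma tent_eq_0: "e > 0 \<Longrightarrow> s \<notin> {a-e..a+e} \<Longrightarrow> tent e a s = 0"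
  unfolding tent_def by (auto simp: max_def)

lemma continuous_tent: "e > 0 \<Longrightarrow> continuous_on S (tent e a)"
  unfolding tent_def by (intro continuous_intros) auto

lemma ramp_left: "e > 0 \<Longrightarrow> s \<le> a - e \<Longrightarrow> ramp e a s = 0"
  by (auto simp: ramp_def pos_sq_def max_def)

lemma ramp_right: "e > 0 \<Longrightarrow> s \<ge> a + e \<Longrightarrow> ramp e a s = 1"
  by (auto simp: ramp_def pos_sq_def max_def field_simps power2_eq_square)

lemma ramp_mono: "e > 0 \<Longrightarrow> s \<le> t \<Longrightarrow> ramp e a s \<le> ramp e a t"
  by (rule DERIV_nonneg_imp_nondecreasing) (use ramp_deriv tent_nonneg in blast)+

lemma ramp_01: assumes "e > 0" shows "0 \<le> ramp e a s" "ramp e a s \<le> 1"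
  using ramp_mono[OF assms, of "min s (a-e)" s a] ramp_mono[OF assms, of s "max s (a+e)" a]
    ramp_left[OF assms, of "min s (a-e)" a] ramp_right[OF assms, of a "max s (a+e)"] by auto

lemma tent_average:
  assumes cont: "continuous_on {0..} \<phi>" and e: "0 < e" "e < a"
    and osc: "\<And>s. s \<in> {a-e..a+e} \<Longrightarrow> \<bar>\<phi> s - \<phi> a\<bar> \<le> d"
  shows "integrable lborel (\<lambda>s. indicator {0..} s *\<^sub>R (\<phi> s * tent e a s))"
    and "\<bar>(LINT s|lborel. indicator {0..} s *\<^sub>R (\<phi> s * tent e a s)) - \<phi> a\<bar> \<le> d"
proof -
  let ?I = "{a-e..a+e}"
  have eq: "(\<lambda>s. indicator {0..} s *\<^sub>R (\<phi> s * tent e a s)) = (\<lambda>s. indicator ?I s *\<^sub>R (\<phi> s * tent e a s))"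
    using tent_eq_0[OF e(1)] e by (force simp: indicator_def)
  have cI: "continuous_on ?I \<phi>" using cont by (rule continuous_on_subset) (use e in auto)
  have int: "integrable lborel (\<lambda>s. indicator ?I s *\<^sub>R (\<psi> s * tent e a s))"
    if "continuous_on ?I \<psi>" for \<psi>
    by (intro borel_integrable_compact continuous_intros that continuous_tent e) auto
  show "integrable lborel (\<lambda>s. indicator {0..} s *\<^sub>R (\<phi> s * tent e a s))"
    unfolding eq by (rule int[OF cI])
  have one: "(LINT s|lborel. indicator ?I s *\<^sub>R tent e a s) = 1"
  proof -
    have "(LINT s|lborel. indicator ?I s *\<^sub>R tent e a s) = ramp e a (a+e) - ramp e a (a-e)"
      by (rule integral_FTC_atLeastAtMost)
         (use e in \<open>auto intro!: continuous_tent has_vector_derivative_at_within ramp_deriv[unfolded has_real_derivative_iff_has_vector_derivative]\<close>)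
    then show ?thesis using e ramp_left ramp_right by simp
  qed
  have it: "integrable lborel (\<lambda>s. indicator ?I s *\<^sub>R tent e a s)"
    using int[of "\<lambda>_. 1"] by simp
  have dif: "(LINT s|lborel. indicator ?I s *\<^sub>R (\<phi> s * tent e a s)) - \<phi> a
     = (LINT s|lborel. indicator ?I s *\<^sub>R (\<phi> s * tent e a s) - \<phi> a * (indicator ?I s *\<^sub>R tent e a s))"
    unfolding Bochner_Integration.integral_diff[OF int[OF cI] integrable_mult_right[OF it]]
    by (subst Bochner_Integration.integral_mult_right[OF it]) (simp only: one mult_1_right)
  have "\<bar>LINT s|lborel. indicator ?I s *\<^sub>R (\<phi> s * tent e a s) - \<phi> a * (indicator ?I s *\<^sub>R tent e a s)\<bar> \<le> (LINT s|lborel. d * (indicator ?I s *\<^sub>R tent e a s))"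
    unfolding real_norm_def[symmetric]
  proof (rule Bochner_Integration.integral_norm_bound_integral)
    fix s
    have "\<bar>\<phi> s - \<phi> a\<bar> * tent e a s \<le> d * tent e a s" if "s \<in> ?I"
      by (intro mult_right_mono osc that tent_nonneg e)
    then show "norm (indicator ?I s *\<^sub>R (\<phi> s * tent e a s) - \<phi> a * (indicator ?I s *\<^sub>R tent e a s))
        \<le> d * (indicator ?I s *\<^sub>R tent e a s)"
      using tent_nonneg[OF e(1), of a s]
      by (auto simp: indicator_def abs_mult left_diff_distrib[symmetric])
  qed (intro Bochner_Integration.integrable_diff int cI integrable_mult_right it)+
  also have "\<dots> = d"
    by (subst Bochner_Integration.integral_mult_right[OF it]) (simp only: one mult_1_right)
  finally show "\<bar>(LINT s|lborel. indicator {0..} s *\<^sub>R (\<phi> s * tent e a s)) - \<phi> a\<bar> \<le> d"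
    unfolding eq dif .
qed

text \<open>Testing the weak derivative against the smoothed indicator of \<open>{a..b}\<close> compares
  \<open>\<phi> a - \<phi> b\<close>, up to the oscillation of \<open>\<phi>\<close> on the scale
  \<open>e\<close> of the smoothing, with the integral of \<open>g\<close> over an interval of
  length \<open>b - a + 2 e\<close>.\<close>
lemma weak_derivative_bound_increment:
  assumes cont: "continuous_on {0..} \<phi>" and L: "L \<ge> 0"
    and g: "AE r in restrict_space lborel {0..}. \<bar>g r\<bar> \<le> L"
    and weak: "\<And>\<psi> \<psi>'. C1c {0<..} \<psi> \<psi>' \<Longrightarrow>
          set_lebesgue_integral lborel {0..} (\<lambda>r. \<phi> r * \<psi>' r)
            = - set_lebesgue_integral lborel {0..} (\<lambda>r. g r * \<psi> r)"
    and ab: "0 < a" "a < b"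
  shows "\<bar>\<phi> a - \<phi> b\<bar> \<le> L * (b - a)"
proof (rule field_le_epsilon)
  fix d :: real assume d: "d > 0"
  have "\<exists>e>0. \<forall>s. \<bar>s - c\<bar> < e \<longrightarrow> \<bar>\<phi> s - \<phi> c\<bar> \<le> d / 4" if "c > 0" for c
  proof -
    have "isCont \<phi> c" using cont that
      by (metis at_within_interior atLeast_iff continuous_on_eq_continuous_within greaterThan_iff
        interior_real_atLeast less_imp_le)
    then obtain e where "e > 0" "\<And>s. dist s c < e \<Longrightarrow> dist (\<phi> s) (\<phi> c) < d / 4"
      unfolding continuous_at_eps_delta using d by (metis divide_pos_pos zero_less_numeral)
    then show ?thesis by (intro exI[of _ e]) (auto simp: dist_real_def less_imp_le)
  qed
  from this[of a] this[of b] obtain ea eb where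
    ea: "ea > 0" "\<And>s. \<bar>s - a\<bar> < ea \<Longrightarrow> \<bar>\<phi> s - \<phi> a\<bar> \<le> d / 4" and
    eb: "eb > 0" "\<And>s. \<bar>s - b\<bar> < eb \<Longrightarrow> \<bar>\<phi> s - \<phi> b\<bar> \<le> d / 4"
    using ab by force
  define e where "e = Min {ea / 2, eb / 2, a / 2, d / (4 * (L + 1))}"
  have e: "0 < e" "e < ea" "e < eb" "e < a" "e \<le> d / (4 * (L + 1))"
    using ea(1) eb(1) ab d L by (auto simp: e_def min_less_iff_disj)
  have Le: "L * (2 * e) \<le> d / 2"
  proof -
    have "L * (2 * e) \<le> (L + 1) * (2 * (d / (4 * (L + 1))))"
      using L e by (intro mult_mono) auto
    also have "\<dots> = d / 2" using L by (simp add: field_simps)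
    finally show ?thesis .
  qed
  define \<psi> where "\<psi> = (\<lambda>s. ramp e a s - ramp e b s)"
  define \<psi>' where "\<psi>' = (\<lambda>s. tent e a s - tent e b s)"
  have supp: "\<psi> s = 0" if "s \<notin> {a-e..b+e}" for s
    using that ab e ramp_left[of e] ramp_right[of e] by (auto simp: \<psi>_def)
  have cl: "closure {p. \<psi> p \<noteq> 0} \<subseteq> {a-e..b+e}"
  proof (rule closure_minimal)
    show "{p. \<psi> p \<noteq> 0} \<subseteq> {a-e..b+e}" using supp by blast
  qed simp
  have "C1c {0<..} \<psi> \<psi>'"
    unfolding C1c_def
  proof (intro conjI allI)
    show "continuous_on UNIV \<psi>'"
      unfolding \<psi>'_def by (intro continuous_intros continuous_tent e)
    have "(\<psi> has_real_derivative \<psi>' p) (at p)" for p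
      unfolding \<psi>_def \<psi>'_def by (intro DERIV_diff ramp_deriv)
    moreover have "(\<lambda>h. \<psi>' p \<bullet> h) = (*) (\<psi>' p)" for p by (simp add: fun_eq_iff)
    ultimately show "(\<psi> has_derivative (\<lambda>h. \<psi>' p \<bullet> h)) (at p)" for p
      by (simp only: has_field_derivative_def)
    show "compact (closure {p. \<psi> p \<noteq> 0})"
      using bounded_subset[OF bounded_closed_interval order_trans[OF closure_subset cl]]
      by (simp add: compact_closure)
    show "closure {p. \<psi> p \<noteq> 0} \<subseteq> {0<..}" using cl e by auto
  qed
  note weak' = weak[OF this]
  have eb': "e < b" using e ab by linarith
  have oa: "\<bar>\<phi> s - \<phi> a\<bar> \<le> d / 4" if "s \<in> {a-e..a+e}" for s
    by (rule ea(2)) (use that e(2) in \<open>simp add: abs_less_iff\<close>)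
  have ob: "\<bar>\<phi> s - \<phi> b\<bar> \<le> d / 4" if "s \<in> {b-e..b+e}" for s
    by (rule eb(2)) (use that e(3) in \<open>simp add: abs_less_iff\<close>)
  have A: "integrable lborel (\<lambda>s. indicator {0..} s *\<^sub>R (\<phi> s * tent e a s))"
     "\<bar>(LINT s|lborel. indicator {0..} s *\<^sub>R (\<phi> s * tent e a s)) - \<phi> a\<bar> \<le> d / 4"
    using tent_average[OF cont e(1,4) oa] by blast+
  have B: "integrable lborel (\<lambda>s. indicator {0..} s *\<^sub>R (\<phi> s * tent e b s))"
     "\<bar>(LINT s|lborel. indicator {0..} s *\<^sub>R (\<phi> s * tent e b s)) - \<phi> b\<bar> \<le> d / 4"
    using tent_average[OF cont e(1) eb' ob] by blast+
  have "set_lebesgue_integral lborel {0..} (\<lambda>r. \<phi> r * \<psi>' r)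
     = (LINT s|lborel. indicator {0..} s *\<^sub>R (\<phi> s * tent e a s)) - (LINT s|lborel. indicator {0..} s *\<^sub>R (\<phi> s * tent e b s))"
    unfolding set_lebesgue_integral_def \<psi>'_def
    by (subst Bochner_Integration.integral_diff[symmetric, OF A(1) B(1)]) (simp add: algebra_simps)
  then have *: "\<bar>\<phi> a - \<phi> b\<bar> \<le> \<bar>set_lebesgue_integral lborel {0..} (\<lambda>r. g r * \<psi> r)\<bar> + d / 2"
    using A(2) B(2) weak' by linarith
  have ind: "integrable lborel (indicat_real {a-e..b+e})"
    by (rule integrable_real_indicator) (auto simp: emeasure_lborel_Icc_eq)
  have "\<bar>set_lebesgue_integral lborel {0..} (\<lambda>r. g r * \<psi> r)\<bar>
     \<le> (LINT r|lborel. L * indicator {a-e..b+e} r)"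
  proof -
    have "AE r in lborel. r \<in> {0..} \<longrightarrow> \<bar>g r\<bar> \<le> L"
      using g AE_restrict_space_iff[of "{0..}" lborel "\<lambda>r. \<bar>g r\<bar> \<le> L"] by simp
    then have ae: "AE r in lborel. norm (indicator {0..} r *\<^sub>R (g r * \<psi> r)) \<le> L * indicator {a-e..b+e} r"
    proof eventually_elim
      case (elim r)
      have "\<bar>\<psi> r\<bar> \<le> 1" using ramp_01[OF e(1), of a r] ramp_01[OF e(1), of b r] by (auto simp: \<psi>_def)
      then have "\<bar>g r\<bar> * \<bar>\<psi> r\<bar> \<le> L * 1" if "r \<ge> 0"
        using elim that L by (intro mult_mono) auto
      then show ?case
        using supp[of r] L by (cases "r \<in> {a-e..b+e}"; cases "r \<ge> 0") (simp_all add: abs_mult)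
    qed
    have i: "integrable lborel (\<lambda>r. L * indicator {a-e..b+e} r)" by (rule integrable_mult_right[OF ind])
    show ?thesis unfolding set_lebesgue_integral_def real_norm_def[symmetric]
      by (rule order_trans[OF integral_norm_bound integral_mono_AE'[OF i ae]]) (simp add: L)
  qed
  also have "\<dots> = L * (b - a + 2 * e)"
    using e ab by (subst Bochner_Integration.integral_mult_right[OF ind]) simp
  finally have "\<bar>set_lebesgue_integral lborel {0..} (\<lambda>r. g r * \<psi> r)\<bar> \<le> L * (b - a) + d / 2"
    using Le by (simp add: algebra_simps)
  then show "\<bar>\<phi> a - \<phi> b\<bar> \<le> L * (b - a) + d"
    using * by linarith
qed

text \<open>Test functions vanish near 0, so the increment bound is available on the open half line only;
  continuity extends it to the end point.\<close>
lemma W1inf_half_line_lipschitz: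
  assumes "W1inf_half_line \<phi>"
  obtains L where "L > 0" "\<And>r s. r \<ge> 0 \<Longrightarrow> s \<ge> 0 \<Longrightarrow> \<bar>\<phi> r - \<phi> s\<bar> \<le> L * \<bar>r - s\<bar>"
proof -
  from assms obtain g C where cont: "continuous_on {0..} \<phi>"
    and C: "AE x in restrict_space lborel {0..}. \<bar>g x\<bar> \<le> C"
    and weak: "\<And>\<psi> \<psi>'. C1c {0<..} \<psi> \<psi>' \<Longrightarrow>
          set_lebesgue_integral lborel {0..} (\<lambda>r. \<phi> r * \<psi>' r)
            = - set_lebesgue_integral lborel {0..} (\<lambda>r. g r * \<psi> r)"
    unfolding W1inf_half_line_def Linf_def by blast
  define L where "L = max 1 C"
  have gL: "AE x in restrict_space lborel {0..}. \<bar>g x\<bar> \<le> L"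
    using C by eventually_elim (auto simp: L_def)
  have pos: "\<bar>\<phi> a - \<phi> b\<bar> \<le> L * \<bar>a - b\<bar>" if "a > 0" "b > 0" for a b
    using weak_derivative_bound_increment[OF cont _ gL weak, of a b]
      weak_derivative_bound_increment[OF cont _ gL weak, of b a] that
    by (cases a b rule: linorder_cases) (auto simp: L_def abs_minus_commute)
  have "\<bar>\<phi> r - \<phi> s\<bar> \<le> L * \<bar>r - s\<bar>" if "r \<ge> 0" "s \<ge> 0" for r s
  proof (rule tendsto_le)
    have lim: "((\<lambda>h. \<phi> (c + h)) \<longlongrightarrow> \<phi> c) (at_right 0)" if "c \<ge> 0" for c
    proof (rule continuous_on_tendsto_compose[OF cont])
      show "((\<lambda>h. c + h) \<longlongrightarrow> c) (at_right 0)" by (auto intro!: tendsto_eq_intros)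
      show "c \<in> {0..}" "\<forall>\<^sub>F h in at_right 0. c + h \<in> {0..}"
        using that by (auto simp: eventually_at_right_field intro!: exI[of _ 1])
    qed
    show "((\<lambda>h. \<bar>\<phi> (r + h) - \<phi> (s + h)\<bar>) \<longlongrightarrow> \<bar>\<phi> r - \<phi> s\<bar>) (at_right 0)"
      by (intro tendsto_intros lim that)
    show "((\<lambda>h. L * \<bar>r - s\<bar>) \<longlongrightarrow> L * \<bar>r - s\<bar>) (at_right (0::real))" by simp
    show "\<forall>\<^sub>F h in at_right 0. \<bar>\<phi> (r + h) - \<phi> (s + h)\<bar> \<le> L * \<bar>r - s\<bar>"
      using pos[of "r + h" "s + h" for h] that
      by (auto simp: eventually_at_right_field intro!: exI[of _ 1])
  qed simp
  moreover have "L > 0" by (simp add: L_def)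
  ultimately show ?thesis by (rule that[rotated])
qed

section \<open>Local boundedness of a first moment\<close>

text \<open>The moment \<open>m\<close> is assumed finite at each time, without any control in time, so
  Gronwall's inequality cannot be started. Three facts replace it. On an interval of length at
  most \<open>1 / (4 c)\<close> on which \<open>m\<close> is bounded, by whatever constant,
  \<open>m\<close> varies by a factor of at most 2, because the pathwise bound can be absorbed
  into itself. By Fatou's lemma, \<open>m\<close> is lower semicontinuous, so its sublevel sets
  are closed. If the closed set \<open>K\<close> of times near which \<open>m\<close> is unbounded
  were nonempty, then by Baire's theorem \<open>m\<close> would be bounded on a nonempty
  relatively open part of \<open>K\<close>; the factor 2 carries that bound across the gaps of
  \<open>K\<close>, which contradicts the definition of \<open>K\<close>.\<close>
lemma first_moment_bounded_on_interval:
  fixes V V' :: "real \<Rightarrow> 'b \<Rightarrow> 'a::euclidean_space" and P :: "'b measure"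
  defines "m \<equiv> \<lambda>t. \<integral>\<omega>. norm (V t \<omega>) \<partial>P"
  assumes "prob_space P" and c: "c > 0"
    and int: "\<And>t. t \<ge> 0 \<Longrightarrow> integrable P (V t)"
    and der: "\<And>\<omega> t. t \<ge> 0 \<Longrightarrow> ((\<lambda>s. V s \<omega>) has_vector_derivative V' t \<omega>) (at t within {0..})"
    and bound: "\<And>\<omega> t. t \<ge> 0 \<Longrightarrow> norm (V' t \<omega>) \<le> c * (m t + norm (V t \<omega>))"
    and T: "T \<ge> 0"
  shows "\<exists>B. \<forall>t\<in>{0..T}. m t \<le> B"
proof -
  interpret prob_space P by fact
  have m0: "0 \<le> m t" for t unfolding m_def by (intro integral_nonneg_AE) auto
  have derI: "((\<lambda>s. V s \<omega>) has_vector_derivative V' t \<omega>) (at t within {a..b})"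
    if "0 \<le> a" "t \<in> {a..b}" for \<omega> t a b
    by (rule has_vector_derivative_within_subset[OF der]) (use that in auto)
  have contI: "continuous_on {a..b} (\<lambda>s. V s \<omega>)" if "0 \<le> a" for \<omega> a b
    using derI[OF that] has_vector_derivative_continuous continuous_on_eq_continuous_within by blast
  have short: "m t \<le> 2 * m s"
    if ab: "0 \<le> a" "b - a \<le> 1 / (4 * c)" and B: "\<And>r. r \<in> {a..b} \<Longrightarrow> m r \<le> B"
      and st: "s \<in> {a..b}" "t \<in> {a..b}" for a b s t B
  proof -
    define S where "S = (SUP r\<in>{a..b}. m r)"
    have bdd: "bdd_above (m ` {a..b})" using B by (intro bdd_aboveI2)
    have mS: "m r \<le> S" if "r \<in> {a..b}" for r
      unfolding S_def by (rule cSUP_upper[OF that bdd])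
    have path: "norm (V r \<omega>) \<le> 4 / 3 * norm (V s \<omega>) + S / 3" if r: "r \<in> {a..b}" for r \<omega>
    proof -
      have "\<exists>u\<in>{a..b}. \<forall>v\<in>{a..b}. norm (V v \<omega>) \<le> norm (V u \<omega>)"
        by (rule continuous_attains_sup) (use st contI ab in \<open>auto intro!: continuous_on_norm\<close>)
      then obtain u where u: "u \<in> {a..b}" "\<And>v. v \<in> {a..b} \<Longrightarrow> norm (V v \<omega>) \<le> norm (V u \<omega>)"
        by blast
      have Q: "norm (V u \<omega>) \<ge> 0" "S \<ge> 0" using mS[OF st(1)] m0[of s] by auto
      have "norm (V u \<omega> - V s \<omega>) \<le> (c * (S + norm (V u \<omega>))) * \<bar>u - s\<bar>"
      proof (rule norm_increment_le[OF derI[OF ab(1)]])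
        fix r assume r: "r \<in> {a..b}"
        have "norm (V' r \<omega>) \<le> c * (m r + norm (V r \<omega>))" using bound r ab by auto
        also have "\<dots> \<le> c * (S + norm (V u \<omega>))"
          using c by (intro mult_left_mono add_mono mS u r) auto
        finally show "norm (V' r \<omega>) \<le> c * (S + norm (V u \<omega>))" .
      qed (use u st in auto)
      also have "\<dots> \<le> (c * (S + norm (V u \<omega>))) * (1 / (4 * c))"
        using u st ab c Q by (intro mult_left_mono) auto
      also have "\<dots> = (S + norm (V u \<omega>)) / 4" using c by simp
      finally have "norm (V u \<omega>) \<le> norm (V s \<omega>) + (S + norm (V u \<omega>)) / 4"
        using norm_triangle_sub[of "V u \<omega>" "V s \<omega>"] by linarith
      then have "3 * norm (V u \<omega>) \<le> 4 * norm (V s \<omega>) + S" by (simp add: field_simps)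
      then show ?thesis using u(2)[OF r] by (simp add: field_simps)
    qed
    have "m r \<le> 4 / 3 * m s + S / 3" if r: "r \<in> {a..b}" for r
    proof -
      have "m r \<le> (\<integral>\<omega>. 4 / 3 * norm (V s \<omega>) + S / 3 \<partial>P)"
        unfolding m_def using r st ab
        by (intro integral_mono path Bochner_Integration.integrable_add integrable_mult_right
            integrable_norm int integrable_const) auto
      also have "\<dots> = 4 / 3 * m s + S / 3"
        using st ab by (simp add: m_def integrable_norm int prob_space)
      finally show ?thesis .
    qed
    then have "S \<le> 4 / 3 * m s + S / 3"
      unfolding S_def using st by (intro cSUP_least) auto
    then show ?thesis using mS[OF st(2)] by simp
  qed
  have lsc: "closed {t \<in> {0..T}. m t \<le> B}" if "B \<ge> 0" for B
    unfolding closed_sequential_limits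
  proof (intro allI impI, elim conjE)
    fix u l assume u: "\<forall>n. u n \<in> {t \<in> {0..T}. m t \<le> B}" and lim: "u \<longlonglongrightarrow> l"
    have l: "l \<in> {0..T}"
      using closed_sequentially[of "{0..T}" u l] u lim by auto
    have un: "0 \<le> u n" "u n \<in> {0..T}" "m (u n) \<le> B" for n using u by auto
    have nn: "ennreal (m t) = (\<integral>\<^sup>+\<omega>. ennreal (norm (V t \<omega>)) \<partial>P)" if "t \<ge> 0" for t
      unfolding m_def by (intro nn_integral_eq_integral[symmetric] integrable_norm int that) auto
    have "ennreal (m l) = (\<integral>\<^sup>+\<omega>. liminf (\<lambda>n. ennreal (norm (V (u n) \<omega>))) \<partial>P)"
      unfolding nn[of l, OF atLeastAtMost_iff[THEN iffD1, OF l, THEN conjunct1]]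
    proof (rule nn_integral_cong)
      fix \<omega>
      have "(\<lambda>n. V (u n) \<omega>) \<longlonglongrightarrow> V l \<omega>"
        by (rule continuous_on_tendsto_compose[OF contI[OF order_refl] lim l]) (use un in auto)
      then have "(\<lambda>n. ennreal (norm (V (u n) \<omega>))) \<longlonglongrightarrow> ennreal (norm (V l \<omega>))"
        by (intro tendsto_ennrealI tendsto_norm)
      then show "ennreal (norm (V l \<omega>)) = liminf (\<lambda>n. ennreal (norm (V (u n) \<omega>)))"
        by (rule lim_imp_Liminf[OF sequentially_bot, symmetric])
    qed
    also have "\<dots> \<le> liminf (\<lambda>n. \<integral>\<^sup>+\<omega>. ennreal (norm (V (u n) \<omega>)) \<partial>P)"
      by (rule nn_integral_liminf) (use int un in auto)
    also have "\<dots> = liminf (\<lambda>n. ennreal (m (u n)))" using nn un by simp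
    also have "\<dots> \<le> liminf (\<lambda>n. ennreal B)"
      by (intro Liminf_mono always_eventually allI ennreal_leI un)
    also have "\<dots> = ennreal B" by (simp add: Liminf_const)
    finally show "l \<in> {t \<in> {0..T}. m t \<le> B}" using l that by (simp add: ennreal_le_iff)
  qed
  define loc where "loc = {t \<in> {0..T}. \<exists>d>0. \<exists>B. \<forall>s\<in>{0..T}. \<bar>s - t\<bar> < d \<longrightarrow> m s \<le> B}"
  \<comment> \<open>\<open>loc\<close> is the set of times with a neighbourhood on which
      \<open>m\<close> is bounded.\<close>
  have compact_loc: "\<exists>B. \<forall>s\<in>{a..b}. m s \<le> B" if "a \<le> b" and abloc: "{a..b} \<subseteq> loc" for a b
  proof -
    have sub: "{a..b} \<subseteq> {0..T}" using that by (auto simp: loc_def)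
    define Q where "Q x y \<longleftrightarrow> (\<exists>B. \<forall>s\<in>{x..y} \<inter> {a..b}. m s \<le> B)" for x y
    have "Q a b"
    proof (rule Bolzano[OF that(1)])
      fix x y z assume "Q x y" "Q y z" "x \<le> y" "y \<le> z"
      then obtain B1 B2 where "\<forall>s\<in>{x..y} \<inter> {a..b}. m s \<le> B1" "\<forall>s\<in>{y..z} \<inter> {a..b}. m s \<le> B2"
        unfolding Q_def by blast
      then have "\<forall>s\<in>{x..z} \<inter> {a..b}. m s \<le> max B1 B2" by (force simp: le_max_iff_disj)
      then show "Q x z" unfolding Q_def by blast
    next
      fix x assume "a \<le> x" "x \<le> b"
      then obtain d B where d: "d > 0" "\<forall>s\<in>{0..T}. \<bar>s - x\<bar> < d \<longrightarrow> m s \<le> B"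
        using abloc unfolding loc_def by force
      show "\<exists>d>0. \<forall>u v. u \<le> x \<and> x \<le> v \<and> v - u < d \<longrightarrow> Q u v"
      proof (intro exI[of _ d] conjI d allI impI)
        fix u v assume "u \<le> x \<and> x \<le> v \<and> v - u < d"
        then show "Q u v" unfolding Q_def using d(2) sub by (intro exI[of _ B]) (force simp: abs_less_iff)
      qed
    qed
    then show ?thesis by (simp add: Q_def)
  qed
  \<comment> \<open>The point \<open>s\<close> itself need not have a neighbourhood on which
      \<open>m\<close> is bounded: approaching it from the other end point, the factor 2 does not
      depend on the local bounds.\<close>
  have reach: "m t \<le> 2 * m s"
    if ab: "0 \<le> a" "b - a \<le> 1 / (4 * c)" and s: "s \<in> {a, b}" and sub: "{a..b} - {s} \<subseteq> loc"
      and t: "t \<in> {a..b}" for a b s t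
  proof -
    define e where "e = (if s = a then b else a)"
    have "m r \<le> max (2 * m e) (m s)" if r: "r \<in> {a..b}" for r
    proof (cases "r = s")
      case False
      have i: "{min r e..max r e} \<subseteq> {a..b}" using r by (auto simp: e_def)
      have "{min r e..max r e} \<subseteq> {a..b} - {s}" using r s False by (auto simp: e_def)
      then obtain B where "\<forall>u\<in>{min r e..max r e}. m u \<le> B"
        using compact_loc[of "min r e" "max r e"] sub by (meson max.cobounded1 min.cobounded1 order_trans)
      then have "m r \<le> 2 * m e"
        using i r ab by (intro short[of "min r e" "max r e" B]) auto
      then show ?thesis by simp
    qed simp
    then show ?thesis
      using s t by (intro short[OF ab, of "max (2 * m e) (m s)"]) auto
  qed
  define K where "K = {0..T} - loc"
  have "closed K"
    unfolding closed_sequential_limits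
  proof (intro allI impI, elim conjE)
    fix u l assume u: "\<forall>n. u n \<in> K" and lim: "u \<longlonglongrightarrow> l"
    have l: "l \<in> {0..T}" using closed_sequentially[of "{0..T}" u l] u lim by (auto simp: K_def)
    have "l \<notin> loc"
    proof
      assume "l \<in> loc"
      then obtain d B where d: "d > 0" "\<And>s. s \<in> {0..T} \<Longrightarrow> \<bar>s - l\<bar> < d \<Longrightarrow> m s \<le> B"
        unfolding loc_def by blast
      from lim have "\<exists>n. \<bar>u n - l\<bar> < d / 2"
        using d LIMSEQ_D[OF lim, of "d / 2"] by (metis half_gt_zero order_refl real_norm_def)
      then obtain n where n: "\<bar>u n - l\<bar> < d / 2" by blast
      have "u n \<in> loc"
      proof -
        have "\<forall>s\<in>{0..T}. \<bar>s - u n\<bar> < d / 2 \<longrightarrow> m s \<le> B"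
        proof (intro ballI impI)
          fix s assume "s \<in> {0..T}" "\<bar>s - u n\<bar> < d / 2"
          then show "m s \<le> B" using n by (intro d(2)) linarith+
        qed
        moreover have "u n \<in> {0..T}" using u by (auto simp: K_def)
        ultimately show ?thesis unfolding loc_def using half_gt_zero[OF d(1)] by blast
      qed
      then show False using u by (auto simp: K_def)
    qed
    then show "l \<in> K" using l by (simp add: K_def)
  qed
  have "K = {}"
  proof (rule ccontr)
    assume ne: "K \<noteq> {}"
    define G where "G = range (\<lambda>n::nat. K - {t \<in> {0..T}. m t \<le> real n})"
    have "\<Inter>G = {}"
    proof (rule ccontr)
      assume "\<Inter>G \<noteq> {}"
      then obtain t where t: "\<And>n::nat. t \<in> K - {t \<in> {0..T}. m t \<le> real n}" unfolding G_def by auto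
      obtain n :: nat where "m t \<le> real n" using real_arch_simple by blast
      then show False using t[of n] by (auto simp: K_def)
    qed
    then have "\<not> K \<subseteq> closure (\<Inter>G)" using ne by auto
    moreover have "countable G" unfolding G_def by auto
    ultimately obtain X where X: "X \<in> G" "\<not> (openin (top_of_set K) X \<and> K \<subseteq> closure X)"
      using Baire[OF \<open>closed K\<close>] by blast
    then obtain n where n: "X = K - {t \<in> {0..T}. m t \<le> real n}" unfolding G_def by auto
    have "openin (top_of_set K) X"
      unfolding n using lsc[of "real n"]
      by (metis Diff_eq Int_commute openin_open open_Compl of_nat_0_le_iff)
    then obtain t0 where t0: "t0 \<in> K" "t0 \<notin> closure X" using X by blast
    then obtain d0 where d0: "d0 > 0" "\<And>t. t \<in> X \<Longrightarrow> \<bar>t - t0\<bar> \<ge> d0"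
      unfolding closure_approachable dist_real_def by (metis not_less)
    define d where "d = min d0 (1 / (8 * c))"
    have d: "d > 0" "d \<le> d0" "d \<le> 1 / (8 * c)" using d0 c by (auto simp: d_def)
    have Kn: "m t \<le> real n" if "t \<in> K" "\<bar>t - t0\<bar> < d" for t
      using d0(2)[of t] that d n by (auto simp: K_def)
    have "m t \<le> 2 * real n" if t: "t \<in> {0..T}" "\<bar>t - t0\<bar> < d" for t
    proof -
      \<comment> \<open>The point \<open>s\<close> of \<open>K\<close> closest to
          \<open>t\<close> on the way to \<open>t0\<close> is an end point of the gap of
          \<open>K\<close> that contains \<open>t\<close>.\<close>
      define A where "A = K \<inter> {min t t0..max t t0}"
      have cA: "compact A" unfolding A_def using \<open>closed K\<close> by (intro closed_Int_compact) auto
      have At0: "t0 \<in> A" using t0 by (auto simp: A_def)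
      have "\<exists>s\<in>A. \<forall>r\<in>A. \<bar>t - s\<bar> \<le> \<bar>t - r\<bar>"
        by (rule continuous_attains_inf[OF cA]) (use At0 in \<open>auto intro!: continuous_intros\<close>)
      then obtain s where s: "s \<in> A" "\<And>r. r \<in> A \<Longrightarrow> \<bar>t - s\<bar> \<le> \<bar>t - r\<bar>" by blast
      have sK: "s \<in> K" "\<bar>s - t0\<bar> < d" "0 \<le> s" "s \<le> T" using s t by (auto simp: A_def K_def)
      have t0T: "t0 \<in> {0..T}" using t0 by (auto simp: K_def)
      have "m t \<le> 2 * m s"
      proof (rule reach[of "min s t" "max s t"])
        show "0 \<le> min s t" using sK t by auto
        have "max s t - min s t < d" using s t by (auto simp: A_def)
        moreover have "1 / (8 * c) \<le> 1 / (4 * c)" using c by (intro divide_left_mono) auto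
        ultimately show "max s t - min s t \<le> 1 / (4 * c)" using d by linarith
        show "s \<in> {min s t, max s t}" "t \<in> {min s t..max s t}" by auto
        show "{min s t..max s t} - {s} \<subseteq> loc"
        proof
          fix r assume r: "r \<in> {min s t..max s t} - {s}"
          then have "\<bar>t - r\<bar> < \<bar>t - s\<bar>" by (auto simp: abs_if min_def max_def split: if_splits)
          then have "r \<notin> A" using s(2)[of r] by linarith
          moreover have "r \<in> {min t t0..max t t0}"
            using r s(1) by (auto simp: A_def min_def max_def split: if_splits)
          moreover have "r \<in> {0..T}" using r sK t by (auto simp: min_def max_def split: if_splits)
          ultimately show "r \<in> loc" by (auto simp: A_def K_def)
        qed
      qed
      then show ?thesis using Kn[OF sK(1,2)] by simp
    qed
    then have "\<exists>d>0. \<exists>B. \<forall>s\<in>{0..T}. \<bar>s - t0\<bar> < d \<longrightarrow> m s \<le> B" using d(1) by blast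
    then have "t0 \<in> loc" unfolding loc_def using t0(1) by (auto simp: K_def)
    then show False using t0 by (auto simp: K_def)
  qed
  then have "{0..T} \<subseteq> loc" by (auto simp: K_def)
  then show ?thesis by (rule compact_loc[OF T])
qed

section \<open>Stability of the mean-field dynamics\<close>

text \<open>The positions \<open>X\<close> and velocities \<open>V\<close> are random variables on an
  arbitrary space \<open>P\<close>, so that two systems can be compared on a common coupling
  space.\<close>
definition mean_field_force ::
    "real \<Rightarrow> (real \<Rightarrow> real) \<Rightarrow> 'b measure \<Rightarrow> ('b \<Rightarrow> 'a::euclidean_space) \<Rightarrow> ('b \<Rightarrow> 'a) \<Rightarrow> 'b \<Rightarrow> 'a" where
  "mean_field_force \<kappa> \<phi> P X V \<omega> = \<kappa> *\<^sub>R (LINT \<omega>'|P. \<phi> (norm (X \<omega> - X \<omega>')) *\<^sub>R (V \<omega>' - V \<omega>))"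

text \<open>For velocities \<open>W \<le> R\<close> the Lipschitz bound \<open>q\<close> on the kernel
  difference \<open>p\<close> is used; for larger velocities only \<open>p \<le> K\<close>, and
  the excess \<open>W - R\<close> is paid for by the exponential moment.\<close>
lemma truncation_bound:
  fixes p q K R W a :: real
  assumes "0 \<le> p" "p \<le> K" "p \<le> q" "0 \<le> R" "a > 0"
  shows "p * W \<le> q * R + K / a * exp (- a * R) * exp (a * W)"
proof (cases "W \<le> R")
  case True
  have "p * W \<le> p * R" using assms True by (intro mult_left_mono) auto
  also have "\<dots> \<le> q * R" using assms by (intro mult_right_mono) auto
  also have "\<dots> \<le> q * R + K / a * exp (- a * R) * exp (a * W)" using assms by simp
  finally show ?thesis .
next
  case False
  have "p * R \<le> q * R" using assms by (intro mult_right_mono) auto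
  moreover have "p * (W - R) \<le> K / a * exp (a * (W - R))"
  proof -
    have "a * (W - R) \<le> exp (a * (W - R))" using exp_ge_add_one_self[of "a * (W - R)"] by linarith
    then have "W - R \<le> exp (a * (W - R)) / a" using assms by (simp add: field_simps)
    then have "p * (W - R) \<le> K * (exp (a * (W - R)) / a)"
      using assms False by (intro mult_mono) auto
    then show ?thesis by simp
  qed
  moreover have "K / a * exp (- a * R) * exp (a * W) = K / a * exp (a * (W - R))"
    by (simp add: algebra_simps flip: exp_add)
  moreover have "p * W = p * R + p * (W - R)" by (simp add: algebra_simps)
  ultimately show ?thesis by linarith
qed

context
  fixes \<phi> :: "real \<Rightarrow> real" and K L \<kappa> :: real
  assumes phi: "\<And>r. r \<ge> 0 \<Longrightarrow> 0 \<le> \<phi> r \<and> \<phi> r \<le> K"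
    and lip: "\<And>r s. r \<ge> 0 \<Longrightarrow> s \<ge> 0 \<Longrightarrow> \<bar>\<phi> r - \<phi> s\<bar> \<le> L * \<bar>r - s\<bar>"
    and K: "K > 0" and L: "L > 0" and kappa: "\<kappa> > 0"
begin

lemma kernel_measurable:
  fixes X :: "'b \<Rightarrow> 'a::euclidean_space"
  assumes [measurable]: "X \<in> borel_measurable P"
  shows "(\<lambda>\<omega>. \<phi> (norm (X \<omega>))) \<in> borel_measurable P"
proof -
  have "continuous_on {0..} \<phi>"
    by (rule lipschitz_on_continuous_on[of L])
       (use lip L in \<open>auto simp: lipschitz_on_def dist_real_def\<close>)
  then have "continuous_on UNIV (\<lambda>u::'a. \<phi> (norm u))"
    by (rule continuous_on_compose2) (auto intro!: continuous_intros)
  then have "(\<lambda>u::'a. \<phi> (norm u)) \<in> borel_measurable borel"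
    by (rule borel_measurable_continuous_onI)
  then show ?thesis by (rule measurable_compose[rotated]) simp
qed

lemma alignment_integrable:
  fixes X V :: "'b \<Rightarrow> 'a::euclidean_space"
  assumes "prob_space P" and [measurable]: "X \<in> borel_measurable P" and V: "integrable P V"
  shows "integrable P (\<lambda>\<omega>'. \<phi> (norm (X \<omega> - X \<omega>')) *\<^sub>R (V \<omega>' - V \<omega>))"
proof -
  interpret prob_space P by fact
  note [measurable] = borel_measurable_integrable[OF V] kernel_measurable
  show ?thesis
  proof (rule Bochner_Integration.integrable_bound)
    show "integrable P (\<lambda>\<omega>'. K *\<^sub>R (V \<omega>' - V \<omega>))" using V by auto
    show "AE \<omega>' in P. norm (\<phi> (norm (X \<omega> - X \<omega>')) *\<^sub>R (V \<omega>' - V \<omega>)) \<le> norm (K *\<^sub>R (V \<omega>' - V \<omega>))"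
    proof (rule AE_I2)
      fix \<omega>'
      have "\<bar>\<phi> (norm (X \<omega> - X \<omega>'))\<bar> \<le> \<bar>K\<bar>" using phi[OF norm_ge_zero] K by (metis abs_of_nonneg abs_of_pos)
      then show "norm (\<phi> (norm (X \<omega> - X \<omega>')) *\<^sub>R (V \<omega>' - V \<omega>)) \<le> norm (K *\<^sub>R (V \<omega>' - V \<omega>))"
        unfolding norm_scaleR by (intro mult_right_mono) auto
    qed
  qed measurable
qed

text \<open>The difference of two interactions splits into \<open>\<phi>\<close> of the first positions
  times the difference of the relative velocities, and the kernel difference times the relative
  velocity of the second system. Only the second term needs the truncation, and only velocities of
  the second system occur in it.\<close>
lemma alignment_diff_bound:
  fixes x1 x2 v1 v2 x1' x2' v1' v2' :: "'a::euclidean_space"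
  assumes R: "0 \<le> R" and a: "a > 0" and W: "norm v2 \<le> W" "norm v2' \<le> W'"
    and e: "norm (x1 - x2) \<le> e" "norm (v1 - v2) \<le> e" "norm (x1' - x2') \<le> e'" "norm (v1' - v2') \<le> e'"
  shows "norm (\<phi> (norm (x1 - x1')) *\<^sub>R (v1' - v1) - \<phi> (norm (x2 - x2')) *\<^sub>R (v2' - v2))
    \<le> K * (e' + e) + (2 * L * R * (e + e') + K / a * exp (- a * R) * (exp (a * W) + exp (a * W')))"
proof -
  define p where "p = \<bar>\<phi> (norm (x1 - x1')) - \<phi> (norm (x2 - x2'))\<bar>"
  have phi': "0 \<le> \<phi> (norm u)" "\<phi> (norm u) \<le> K" for u :: 'a using phi by auto
  have p: "0 \<le> p" "p \<le> K"
    using phi'[of "x1 - x1'"] phi'[of "x2 - x2'"] by (auto simp: p_def)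
  have "\<bar>norm (x1 - x1') - norm (x2 - x2')\<bar> \<le> norm ((x1 - x1') - (x2 - x2'))"
    by (rule norm_triangle_ineq3)
  also have "(x1 - x1') - (x2 - x2') = (x1 - x2) - (x1' - x2')" by simp
  also have "norm \<dots> \<le> e + e'" using e norm_triangle_ineq4[of "x1 - x2" "x1' - x2'"] by linarith
  finally have "L * \<bar>norm (x1 - x1') - norm (x2 - x2')\<bar> \<le> L * (e + e')"
    using L by (intro mult_left_mono) auto
  then have pq: "p \<le> L * (e + e')"
    unfolding p_def using lip[of "norm (x1 - x1')" "norm (x2 - x2')"] by simp
  have "\<phi> (norm (x1 - x1')) *\<^sub>R (v1' - v1) - \<phi> (norm (x2 - x2')) *\<^sub>R (v2' - v2)
     = \<phi> (norm (x1 - x1')) *\<^sub>R ((v1' - v2') - (v1 - v2))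
       + (\<phi> (norm (x1 - x1')) - \<phi> (norm (x2 - x2'))) *\<^sub>R (v2' - v2)"
    by (simp add: algebra_simps)
  also have "norm \<dots> \<le> \<phi> (norm (x1 - x1')) * norm ((v1' - v2') - (v1 - v2)) + p * norm (v2' - v2)"
    using phi'(1)[of "x1 - x1'"] by (intro order_trans[OF norm_triangle_ineq]) (simp add: p_def)
  also have "\<dots> \<le> K * (e' + e) + p * (W + W')"
    using e W p phi' norm_triangle_ineq4[of "v1' - v2'" "v1 - v2"] norm_triangle_ineq4[of v2' v2] K
    by (intro add_mono mult_mono) auto
  also have "\<dots> = K * (e' + e) + (p * W + p * W')" by (simp add: algebra_simps)
  also have "\<dots> \<le> K * (e' + e) + ((L * (e + e') * R + K / a * exp (- a * R) * exp (a * W))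
       + (L * (e + e') * R + K / a * exp (- a * R) * exp (a * W')))"
    by (intro add_mono order_refl truncation_bound p pq R a)
  finally show ?thesis by (simp add: algebra_simps add_divide_distrib)
qed

lemma mean_field_force_diff_bound:
  fixes X1 V1 X2 V2 :: "'b \<Rightarrow> 'a::euclidean_space" and W :: "'b \<Rightarrow> real"
  defines "e \<equiv> \<lambda>\<omega>. dist (X1 \<omega>, V1 \<omega>) (X2 \<omega>, V2 \<omega>)"
  assumes P: "prob_space P" and R: "0 \<le> R" and a: "a > 0"
    and meas: "X1 \<in> borel_measurable P" "X2 \<in> borel_measurable P"
    and int: "integrable P V1" "integrable P V2" "integrable P e" "integrable P (\<lambda>\<omega>. exp (a * W \<omega>))"
    and W: "AE \<omega> in P. norm (V2 \<omega>) \<le> W \<omega>" "norm (V2 \<omega>0) \<le> W \<omega>0"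
  shows "norm (mean_field_force \<kappa> \<phi> P X1 V1 \<omega>0 - mean_field_force \<kappa> \<phi> P X2 V2 \<omega>0)
    \<le> (\<kappa> * K + 2 * \<kappa> * L * R) * (e \<omega>0 + (\<integral>\<omega>. e \<omega> \<partial>P))
      + \<kappa> * K / a * exp (- a * R) * (exp (a * W \<omega>0) + (\<integral>\<omega>. exp (a * W \<omega>) \<partial>P))"
proof -
  interpret prob_space P by (rule P)
  have comp: "norm (X1 \<omega> - X2 \<omega>) \<le> e \<omega>" "norm (V1 \<omega> - V2 \<omega>) \<le> e \<omega>" for \<omega>
    using norm_fst_le[of "X1 \<omega> - X2 \<omega>" "V1 \<omega> - V2 \<omega>"] norm_snd_le[of "V1 \<omega> - V2 \<omega>" "X1 \<omega> - X2 \<omega>"]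
    by (simp_all add: e_def dist_norm)
  let ?A = "\<lambda>X V \<omega>'. \<phi> (norm (X \<omega>0 - X \<omega>')) *\<^sub>R (V \<omega>' - V \<omega>0)"
  let ?b = "\<lambda>\<omega>. K * (e \<omega> + e \<omega>0) + (2 * L * R * (e \<omega>0 + e \<omega>) + K / a * exp (- a * R) * (exp (a * W \<omega>0) + exp (a * W \<omega>)))"
  have i1: "integrable P (?A X1 V1)" "integrable P (?A X2 V2)"
    by (intro alignment_integrable P meas int)+
  have ib: "integrable P ?b"
    by (intro Bochner_Integration.integrable_add integrable_mult_right int integrable_const)
  have "norm (mean_field_force \<kappa> \<phi> P X1 V1 \<omega>0 - mean_field_force \<kappa> \<phi> P X2 V2 \<omega>0)
     = \<kappa> * norm (\<integral>\<omega>. ?A X1 V1 \<omega> - ?A X2 V2 \<omega> \<partial>P)"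
    unfolding mean_field_force_def using kappa
    by (subst Bochner_Integration.integral_diff[OF i1]) (simp flip: scaleR_diff_right)
  also have "\<dots> \<le> \<kappa> * (\<integral>\<omega>. norm (?A X1 V1 \<omega> - ?A X2 V2 \<omega>) \<partial>P)"
    using kappa by (intro mult_left_mono integral_norm_bound) auto
  also have "\<dots> \<le> \<kappa> * (\<integral>\<omega>. ?b \<omega> \<partial>P)"
  proof (intro mult_left_mono integral_mono_AE ib)
    show "AE \<omega> in P. norm (?A X1 V1 \<omega> - ?A X2 V2 \<omega>) \<le> ?b \<omega>"
      using W(1) by eventually_elim (rule alignment_diff_bound[OF R a W(2) _ comp comp])
  qed (use kappa i1 in \<open>auto intro!: integrable_norm Bochner_Integration.integrable_diff\<close>)
  also have "(\<integral>\<omega>. ?b \<omega> \<partial>P) = K * ((\<integral>\<omega>. e \<omega> \<partial>P) + e \<omega>0) + (2 * L * R * (e \<omega>0 + (\<integral>\<omega>. e \<omega> \<partial>P))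
      + K / a * exp (- a * R) * (exp (a * W \<omega>0) + (\<integral>\<omega>. exp (a * W \<omega>) \<partial>P)))"
    using int by (simp add: prob_space)
  finally show ?thesis by (simp add: algebra_simps add_divide_distrib)
qed

end

text \<open>The mean distance is controlled by a bootstrap: an assumed bound \<open>D \<le> m S\<close> on
  \<open>{0..T}\<close>, for an explicit \<open>S\<close>, is fed into the differential inequality
  along almost every single trajectory, and averaging the resulting pathwise bounds improves
  \<open>m\<close> to \<open>1 + m / 2\<close>. Hence the best constant is at most 2. Regularity
  in time enters only along single trajectories; \<open>D\<close> itself is never differentiated
  or integrated in time.\<close>
theorem mean_field_stability:
  fixes \<phi> :: "real \<Rightarrow> real" and K L \<kappa> a R0 T :: real
    and X1 V1 X2 V2 :: "real \<Rightarrow> 'b \<Rightarrow> 'a::euclidean_space" and W :: "'b \<Rightarrow> real" and P :: "'b measure"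
  defines "e \<equiv> \<lambda>t \<omega>. dist (X1 t \<omega>, V1 t \<omega>) (X2 t \<omega>, V2 t \<omega>)"
  defines "D \<equiv> \<lambda>t. \<integral>\<omega>. e t \<omega> \<partial>P"
    and "E \<equiv> \<integral>\<omega>. exp (a * W \<omega>) \<partial>P"
    and "lam \<equiv> 12 * \<kappa> * L / a"
  assumes phi: "\<And>r. r \<ge> 0 \<Longrightarrow> 0 \<le> \<phi> r \<and> \<phi> r \<le> K"
    and lip: "\<And>r s. r \<ge> 0 \<Longrightarrow> s \<ge> 0 \<Longrightarrow> \<bar>\<phi> r - \<phi> s\<bar> \<le> L * \<bar>r - s\<bar>"
    and K: "K > 0" and L: "L > 0" and kappa: "\<kappa> > 0" and a: "a > 0" and R0: "R0 \<ge> 0" and T: "T > 0"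
    and P: "prob_space P"
    and meas: "\<And>t. t \<in> {0..T} \<Longrightarrow> X1 t \<in> borel_measurable P" "\<And>t. t \<in> {0..T} \<Longrightarrow> X2 t \<in> borel_measurable P"
    and int: "\<And>t. t \<in> {0..T} \<Longrightarrow> integrable P (V1 t)" "\<And>t. t \<in> {0..T} \<Longrightarrow> integrable P (V2 t)"
       "\<And>t. t \<in> {0..T} \<Longrightarrow> integrable P (e t)" "integrable P (\<lambda>\<omega>. exp (a * W \<omega>))"
    and Db: "\<And>t. t \<in> {0..T} \<Longrightarrow> D t \<le> Db"
    and W: "AE \<omega> in P. \<forall>t\<in>{0..T}. norm (V2 t \<omega>) \<le> W \<omega>"
    and dX1: "AE \<omega> in P. \<forall>t\<in>{0..T}. ((\<lambda>t. X1 t \<omega>) has_vector_derivative V1 t \<omega>) (at t within {0..T})"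
    and dV1: "AE \<omega> in P. \<forall>t\<in>{0..T}. ((\<lambda>t. V1 t \<omega>) has_vector_derivative mean_field_force \<kappa> \<phi> P (X1 t) (V1 t) \<omega>) (at t within {0..T})"
    and dX2: "AE \<omega> in P. \<forall>t\<in>{0..T}. ((\<lambda>t. X2 t \<omega>) has_vector_derivative V2 t \<omega>) (at t within {0..T})"
    and dV2: "AE \<omega> in P. \<forall>t\<in>{0..T}. ((\<lambda>t. V2 t \<omega>) has_vector_derivative mean_field_force \<kappa> \<phi> P (X2 t) (V2 t) \<omega>) (at t within {0..T})"
    and t: "t \<in> {0..T}"
  shows "D t \<le> 2 * exp ((1 + 3 * \<kappa> * K) * T) *
      (exp (a / 2 * R0) * D 0 + (T + 1) * (2 * \<kappa> * K * E / a) * exp (- (a / 2) * R0 * exp (- lam * T)))"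
proof -
  interpret prob_space P by (rule P)
  have D0: "0 \<le> D t" for t unfolding D_def e_def by (intro integral_nonneg_AE) auto
  have lam: "lam > 0" "a * lam = 12 * \<kappa> * L" using kappa L a by (simp_all add: lam_def)
  have E: "E \<ge> 1"
  proof -
    have "(\<integral>\<omega>. 1 \<partial>P) \<le> E"
      unfolding E_def
    proof (rule integral_mono_AE[OF _ int(4)])
      show "AE \<omega> in P. 1 \<le> exp (a * W \<omega>)"
        using W
      proof eventually_elim
        case (elim \<omega>)
        then have "0 \<le> W \<omega>" using T norm_ge_zero order_trans by (metis atLeastAtMost_iff order_refl less_imp_le)
        then show ?case using a by simp
      qed
    qed simp
    then show ?thesis by (simp add: prob_space)
  qed
  define R where "R s = R0 * exp (- lam * s)" for s
  have R: "0 \<le> R s" "R s \<le> R0" if "s \<in> {0..T}" for s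
    using that R0 lam by (auto simp: R_def mult_left_le)
  have RT: "R T \<le> R s" if "s \<in> {0..T}" for s
    using that R0 lam by (auto simp: R_def intro!: mult_left_mono)
  have dR: "(R has_real_derivative (- lam * R s)) (at s within {0..T})" for s
    unfolding R_def by (auto intro!: derivative_eq_intros)
  \<comment> \<open>Along a trajectory, the distance is multiplied by \<open>b1\<close> and
      the mean distance \<open>D\<close> by \<open>b2\<close>. \<open>S\<close> is built with the
      rate \<open>b1 + 2 b2\<close>; the doubled \<open>b2\<close> is what produces the factor
      \<open>1 / 2\<close> in the bootstrap. With \<open>lam = 12 \<kappa> L / a\<close> the
      primitive of this rate is exactly \<open>B\<close>.\<close>
  define b1 where "b1 s = 1 + \<kappa> * K + 2 * \<kappa> * L * R s" for s
  define b2 where "b2 s = \<kappa> * K + 2 * \<kappa> * L * R s" for s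
  define B1 where "B1 s = (1 + \<kappa> * K) * s + a / 6 * (R0 - R s)" for s
  define B where "B s = (1 + 3 * \<kappa> * K) * s + a / 2 * (R0 - R s)" for s
  have b: "0 \<le> b1 s" "0 \<le> b2 s" if "s \<in> {0..T}" for s
    using R[OF that] kappa K L by (simp_all add: b1_def b2_def)
  have dB1: "(B1 has_real_derivative b1 s) (at s within {0..T})" for s
  proof -
    have "(B1 has_real_derivative (1 + \<kappa> * K + a / 6 * (lam * R s))) (at s within {0..T})"
      unfolding B1_def by (auto intro!: derivative_eq_intros dR)
    also have "1 + \<kappa> * K + a / 6 * (lam * R s) = 1 + \<kappa> * K + (a * lam) * R s / 6" by simp
    also have "\<dots> = b1 s" unfolding lam(2) b1_def by simp
    finally show ?thesis .
  qed
  have dB: "(B has_real_derivative (b1 s + 2 * b2 s)) (at s within {0..T})" for s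
  proof -
    have "(B has_real_derivative (1 + 3 * \<kappa> * K + a / 2 * (lam * R s))) (at s within {0..T})"
      unfolding B_def by (auto intro!: derivative_eq_intros dR)
    also have "1 + 3 * \<kappa> * K + a / 2 * (lam * R s) = 1 + 3 * \<kappa> * K + (a * lam) * R s / 2" by simp
    also have "\<dots> = b1 s + 2 * b2 s" unfolding lam(2) b1_def b2_def by simp
    finally show ?thesis .
  qed
  define c where "c = 2 * \<kappa> * K * E / a"
  define c3 where "c3 = c * exp (- (a / 2) * (R0 + R T))"
  have c: "c > 0" "c3 > 0" using kappa K a E by (simp_all add: c_def c3_def)
  \<comment> \<open>The source term \<open>exp (- a R s)\<close> is written as a product of
      two square roots: one is absorbed by the growth factor \<open>exp (B s)\<close>, the other
      is at most its value at the final time \<open>T\<close>.\<close>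
  have source: "c * exp (- a * R s) \<le> c3 * exp (B s)" if s: "s \<in> {0..T}" for s
  proof -
    have "- a * R s \<le> - (a / 2) * (R0 + R T) + B s"
    proof -
      have "a / 2 * R T \<le> a / 2 * R s" using RT[OF s] a by simp
      moreover have "0 \<le> (1 + 3 * \<kappa> * K) * s" using s kappa K by simp
      moreover have "- (a / 2) * (R0 + R T) + a / 2 * (R0 - R s) = - (a / 2 * R T) - a / 2 * R s"
        by (simp add: right_diff_distrib distrib_left)
      moreover have "- a * R s = - (a / 2 * R s) - a / 2 * R s" by simp
      ultimately show ?thesis unfolding B_def by linarith
    qed
    then have "exp (- a * R s) \<le> exp (- (a / 2) * (R0 + R T)) * exp (B s)"
      by (simp flip: exp_add)
    then show ?thesis unfolding c3_def mult.assoc using c by (intro mult_left_mono) auto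
  qed
  \<comment> \<open>\<open>s + 1\<close> in place of \<open>s\<close> keeps \<open>S\<close>
      bounded away from 0, so that \<open>D / S\<close> is bounded.\<close>
  define S where "S s = exp (B s) * (D 0 + c3 * (s + 1))" for s
  have S: "c3 \<le> S s" if s: "s \<in> {0..T}" for s
  proof -
    have "0 \<le> B s" using R[OF s] s kappa K a by (simp add: B_def)
    then have "1 * (c3 * 1) \<le> exp (B s) * (D 0 + c3 * (s + 1))"
      using c s D0[of 0] by (intro mult_mono) (auto intro!: add_increasing mult_left_mono)
    then show ?thesis by (simp add: S_def)
  qed
  have dS: "(S has_real_derivative ((b1 s + 2 * b2 s) * S s + c3 * exp (B s))) (at s within {0..T})" for s
    unfolding S_def by (auto intro!: derivative_eq_intros dB simp: algebra_simps)
  have boot: "D t \<le> (1 + m / 2) * S t"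
    if m: "m \<ge> 0" and bd: "\<And>s. s \<in> {0..T} \<Longrightarrow> D s \<le> m * S s" and t: "t \<in> {0..T}" for m t
  proof -
    \<comment> \<open>\<open>h\<close> is the pathwise size of the truncation error,
        normalized to have mean 1.\<close>
    define h where "h \<omega> = (exp (a * W \<omega>) / E + 1) / 2" for \<omega>
    define y where "y \<omega> s = exp (B s) * (e 0 \<omega> + c3 * (s + 1) * h \<omega>) + m / 2 * S s" for \<omega> s
    have h: "0 \<le> h \<omega>" for \<omega> using E by (simp add: h_def)
    have "AE \<omega> in P. e t \<omega> \<le> y \<omega> t"
      using W dX1 dV1 dX2 dV2
    proof eventually_elim
      case (elim \<omega>)
      let ?w = "\<lambda>s. (X1 s \<omega> - X2 s \<omega>, V1 s \<omega> - V2 s \<omega>)"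
      let ?F = "\<lambda>s. mean_field_force \<kappa> \<phi> P (X1 s) (V1 s) \<omega> - mean_field_force \<kappa> \<phi> P (X2 s) (V2 s) \<omega>"
      let ?w' = "\<lambda>s. (V1 s \<omega> - V2 s \<omega>, ?F s)"
      let ?g = "\<lambda>s. b2 s * D s + c * exp (- a * R s) * h \<omega>"
      have ew: "e s \<omega> = norm (?w s)" for s by (simp add: e_def dist_norm)
      have "norm (?w t) \<le> y \<omega> t"
      proof (rule norm_le_by_comparison[where w = ?w and y = "y \<omega>" and t = t and w' = ?w' and B = B1
            and y' = "\<lambda>s. (b1 s + 2 * b2 s) * y \<omega> s + exp (B s) * c3 * h \<omega> + m / 2 * (c3 * exp (B s))" and b = b1 and g = ?g and T = T])
        fix s assume s: "s \<in> {0..T}"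
        show "(?w has_vector_derivative ?w' s) (at s within {0..T})"
          using elim(2,3,4,5) s by (intro has_vector_derivative_Pair has_vector_derivative_diff) auto
        show "(y \<omega> has_real_derivative
            ((b1 s + 2 * b2 s) * y \<omega> s + exp (B s) * c3 * h \<omega> + m / 2 * (c3 * exp (B s)))) (at s within {0..T})"
          unfolding y_def[abs_def] by (auto intro!: derivative_eq_intros dB dS simp: algebra_simps)
        show "(B1 has_real_derivative b1 s) (at s within {0..T})" by (rule dB1)
        show "0 \<le> b1 s" using b[OF s] by simp
        show "0 \<le> ?g s" using b[OF s] D0[of s] c h[of \<omega>] by simp
        have "AE \<omega>' in P. norm (V2 s \<omega>') \<le> W \<omega>'" using W by eventually_elim (use s in auto)
        then have "norm (?F s) \<le> b2 s * (e s \<omega> + D s) + \<kappa> * K / a * exp (- a * R s) * (exp (a * W \<omega>) + E)"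
          unfolding b2_def D_def E_def e_def
          using elim(1) s int(3)[OF s, unfolded e_def]
          by (intro mean_field_force_diff_bound phi lip K L kappa P R a meas int) auto
        also have "\<kappa> * K / a * exp (- a * R s) * (exp (a * W \<omega>) + E) = c * exp (- a * R s) * h \<omega>"
        proof -
          have "E * h \<omega> * 2 = exp (a * W \<omega>) + E" using E by (simp add: h_def distrib_left)
          then show ?thesis by (simp add: c_def flip: \<open>E * h \<omega> * 2 = exp (a * W \<omega>) + E\<close>)
        qed
        finally have F: "norm (?F s) \<le> b2 s * (norm (?w s) + D s) + c * exp (- a * R s) * h \<omega>"
          by (simp only: ew)
        have "?w s \<bullet> ?w' s \<le> norm (?w s) * norm (?w' s)" by (rule norm_cauchy_schwarz)
        also have "norm (?w' s) \<le> norm (V1 s \<omega> - V2 s \<omega>) + norm (?F s)"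
          by (rule norm_Pair_le)
        also have "\<dots> \<le> norm (?w s) + (b2 s * (norm (?w s) + D s) + c * exp (- a * R s) * h \<omega>)"
          by (intro add_mono F norm_snd_le)
        also have "\<dots> = b1 s * norm (?w s) + ?g s"
          by (simp add: b1_def b2_def algebra_simps)
        finally show "?w s \<bullet> ?w' s \<le> norm (?w s) * (b1 s * norm (?w s) + ?g s)"
          by (simp add: mult_left_mono)
        have "m / 2 * S s \<le> y \<omega> s"
          unfolding y_def using s c h[of \<omega>] by (auto simp: e_def)
        then have "2 * b2 s * (m / 2 * S s) \<le> 2 * b2 s * y \<omega> s"
          using b[OF s] by (intro mult_left_mono) auto
        moreover have "b2 s * D s \<le> b2 s * (m * S s)"
          using b[OF s] bd[OF s] by (intro mult_left_mono) auto
        moreover have "c * exp (- a * R s) * h \<omega> \<le> c3 * exp (B s) * h \<omega>"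
          by (intro mult_right_mono source s h)
        moreover have "0 \<le> m / 2 * (c3 * exp (B s))" using m c by simp
        ultimately show "b1 s * y \<omega> s + ?g s
            \<le> (b1 s + 2 * b2 s) * y \<omega> s + exp (B s) * c3 * h \<omega> + m / 2 * (c3 * exp (B s))"
          by (simp add: algebra_simps)
      next
        have "B 0 = 0" by (simp add: B_def R_def)
        moreover have "0 \<le> S 0" using S[of 0] c T by simp
        ultimately show "norm (?w 0) \<le> y \<omega> 0"
          unfolding y_def ew[symmetric] using c h[of \<omega>] m by simp
      qed (rule t)
      then show ?case by (simp only: ew)
    qed
    then have "D t \<le> (\<integral>\<omega>. y \<omega> t \<partial>P)"
      unfolding D_def using int t T
      by (intro integral_mono_AE) (auto simp: y_def h_def)
    also have "\<dots> = exp (B t) * (D 0 + c3 * (t + 1) * (\<integral>\<omega>. h \<omega> \<partial>P)) + m / 2 * S t"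
      unfolding y_def h_def D_def using int T by (simp add: prob_space)
    also have "(\<integral>\<omega>. h \<omega> \<partial>P) = (E / E + 1) / 2"
      unfolding h_def using int(4) by (simp add: E_def prob_space)
    also have "\<dots> = 1" using E by simp
    finally show ?thesis by (simp add: S_def algebra_simps)
  qed
  have D2S: "D t \<le> 2 * S t" if t: "t \<in> {0..T}" for t
  proof -
    define m where "m = (SUP s\<in>{0..T}. D s / S s)"
    have pos: "0 < S s" if "s \<in> {0..T}" for s using S[OF that] c by simp
    have "bdd_above ((\<lambda>s. D s / S s) ` {0..T})"
    proof (rule bdd_aboveI2)
      fix s assume s: "s \<in> {0..T}"
      show "D s / S s \<le> Db / c3"
        using D0[of s] Db[OF s] S[OF s] c by (intro frac_le) auto
    qed
    then have up: "D s / S s \<le> m" if "s \<in> {0..T}" for s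
      unfolding m_def by (rule cSUP_upper[OF that])
    then have bd: "D s \<le> m * S s" if "s \<in> {0..T}" for s
      using pos[OF that] up[OF that] that by (simp add: divide_le_eq)
    have "0 \<le> D t / S t" using D0[of t] pos[OF t] by simp
    then have m0: "0 \<le> m" using up[OF t] by linarith
    have "D s / S s \<le> 1 + m / 2" if "s \<in> {0..T}" for s
      using boot[OF m0 bd that] pos[OF that] by (simp add: divide_le_eq)
    then have "m \<le> 1 + m / 2" unfolding m_def using T by (intro cSUP_least) auto
    then have "m * S t \<le> 2 * S t" using pos[OF t] by (intro mult_right_mono) auto
    then show ?thesis using bd[OF t] by linarith
  qed
  have "S t \<le> exp ((1 + 3 * \<kappa> * K) * T) * exp (a / 2 * R0) * (D 0 + c3 * (T + 1))"
  proof -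
    have "B t \<le> (1 + 3 * \<kappa> * K) * T + a / 2 * R0"
      unfolding B_def using t R[OF t] kappa K a by (intro add_mono mult_left_mono) auto
    then have "exp (B t) \<le> exp ((1 + 3 * \<kappa> * K) * T) * exp (a / 2 * R0)" by (simp flip: exp_add)
    then show ?thesis
      unfolding S_def using t c D0[of 0] by (intro mult_mono add_mono mult_left_mono) auto
  qed
  also have "\<dots> = exp ((1 + 3 * \<kappa> * K) * T) * (exp (a / 2 * R0) * D 0 + (T + 1) * c * exp (- (a / 2) * R T))"
  proof -
    have "exp (- (a / 2) * (R0 + R T)) = exp (- (a / 2) * R0) * exp (- (a / 2) * R T)"
      by (simp add: algebra_simps flip: exp_add)
    then have "exp (a / 2 * R0) * c3
        = (exp (a / 2 * R0) * exp (- (a / 2) * R0)) * (c * exp (- (a / 2) * R T))"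
      unfolding c3_def by (simp only: mult_ac)
    also have "exp (a / 2 * R0) * exp (- (a / 2) * R0) = 1" by (simp flip: exp_add)
    finally have "exp (a / 2 * R0) * c3 = c * exp (- (a / 2) * R T)" by simp
    then have "exp (a / 2 * R0) * (D 0 + c3 * (T + 1))
       = exp (a / 2 * R0) * D 0 + (T + 1) * c * exp (- (a / 2) * R T)"
      using distrib_left[of "exp (a / 2 * R0)" "D 0" "c3 * (T + 1)"] by (simp only: mult.assoc[symmetric]) (simp only: mult_ac)
    then show ?thesis by (simp only: mult.assoc)
  qed
  finally show ?thesis
    using D2S[OF t] by (simp add: c_def R_def mult.assoc)
qed

section \<open>Wasserstein stability of flows\<close>

text \<open>The differential equations are required for almost every starting point only: the flow of a
  particle system is determined only at the finitely many initial positions. The integrable bound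
  \<open>G\<close> makes all trajectory distances integrable and their means bounded on
  \<open>{0..T}\<close>.\<close>
definition mean_field_flow ::
    "real \<Rightarrow> (real \<Rightarrow> real) \<Rightarrow> real \<Rightarrow> ('a \<times> 'a) measure \<Rightarrow> (real \<Rightarrow> ('a::euclidean_space \<times> 'a) \<Rightarrow> 'a \<times> 'a) \<Rightarrow> bool" where
  "mean_field_flow \<kappa> \<phi> T \<mu> \<Psi> \<longleftrightarrow>
     (\<forall>t\<in>{0..T}. \<Psi> t \<in> borel_measurable borel) \<and>
     (AE z in \<mu>. \<Psi> 0 z = z) \<and>
     (AE z in \<mu>. \<forall>t\<in>{0..T}. ((\<lambda>t. fst (\<Psi> t z)) has_vector_derivative snd (\<Psi> t z)) (at t within {0..T})) \<and>
     (AE z in \<mu>. \<forall>t\<in>{0..T}. ((\<lambda>t. snd (\<Psi> t z)) has_vector_derivative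
        mean_field_force \<kappa> \<phi> \<mu> (\<lambda>z. fst (\<Psi> t z)) (\<lambda>z. snd (\<Psi> t z)) z) (at t within {0..T})) \<and>
     (\<exists>G. integrable \<mu> G \<and> (AE z in \<mu>. \<forall>t\<in>{0..T}. norm (\<Psi> t z) \<le> G z))"

lemma coupling_marginals:
  assumes "\<pi> \<in> couplings \<mu> \<nu>"
  shows "fst \<in> measurable \<pi> \<mu>" "snd \<in> measurable \<pi> \<nu>" "distr \<pi> \<mu> fst = \<mu>" "distr \<pi> \<nu> snd = \<nu>"
proof -
  have s: "sets \<pi> = sets (\<mu> \<Otimes>\<^sub>M \<nu>)" using assms by (simp add: couplings_def)
  show "fst \<in> measurable \<pi> \<mu>" "snd \<in> measurable \<pi> \<nu>"
    unfolding measurable_cong_sets[OF s refl] by measurable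
qed (use assms in \<open>simp_all add: couplings_def\<close>)

lemma W1_distr_le:
  fixes F G :: "'a::{metric_space, second_countable_topology} \<Rightarrow> 'a"
  assumes pi: "\<pi> \<in> couplings \<mu> \<nu>" and sets: "sets \<mu> = sets borel" "sets \<nu> = sets borel"
    and F: "F \<in> borel_measurable borel" and G: "G \<in> borel_measurable borel"
  shows "W1 (distr \<mu> borel F) (distr \<nu> borel G) \<le> (\<integral>\<^sup>+p. ennreal (dist (F (fst p)) (G (snd p))) \<partial>\<pi>)"
proof -
  note marg = coupling_marginals[OF pi]
  have m1: "fst \<in> borel_measurable \<pi>" using marg(1) by (simp add: measurable_cong_sets[OF refl sets(1)])
  have m2: "snd \<in> borel_measurable \<pi>" using marg(2) by (simp add: measurable_cong_sets[OF refl sets(2)])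
  have Fm: "(\<lambda>p. F (fst p)) \<in> borel_measurable \<pi>" by (rule measurable_compose[OF m1 F])
  have Gm: "(\<lambda>p. G (snd p)) \<in> borel_measurable \<pi>" by (rule measurable_compose[OF m2 G])
  define \<rho> where "\<rho> = distr \<pi> (borel \<Otimes>\<^sub>M borel) (\<lambda>p. (F (fst p), G (snd p)))"
  have h: "(\<lambda>p. (F (fst p), G (snd p))) \<in> measurable \<pi> (borel \<Otimes>\<^sub>M borel)"
    by (rule measurable_Pair[OF Fm Gm])
  have "\<rho> \<in> couplings (distr \<mu> borel F) (distr \<nu> borel G)"
    unfolding couplings_def
  proof (intro CollectI conjI)
    show "sets \<rho> = sets (distr \<mu> borel F \<Otimes>\<^sub>M distr \<nu> borel G)"
      unfolding \<rho>_def sets_distr by (intro sets_pair_measure_cong) simp_all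
    have "distr \<rho> (distr \<mu> borel F) fst = distr \<rho> borel fst" by (intro distr_cong) auto
    also have "\<dots> = distr \<pi> borel (\<lambda>p. F (fst p))"
      unfolding \<rho>_def by (subst distr_distr[OF _ h]) (auto simp: comp_def)
    also have "\<dots> = distr (distr \<pi> \<mu> fst) borel F"
      by (subst distr_distr[OF _ marg(1)]) (use F in \<open>auto simp: comp_def measurable_cong_sets[OF sets(1) refl]\<close>)
    finally show "distr \<rho> (distr \<mu> borel F) fst = distr \<mu> borel F" using marg(3) by simp
    have "distr \<rho> (distr \<nu> borel G) snd = distr \<rho> borel snd" by (intro distr_cong) auto
    also have "\<dots> = distr \<pi> borel (\<lambda>p. G (snd p))"
      unfolding \<rho>_def by (subst distr_distr[OF _ h]) (auto simp: comp_def)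
    also have "\<dots> = distr (distr \<pi> \<nu> snd) borel G"
      by (subst distr_distr[OF _ marg(2)]) (use G in \<open>auto simp: comp_def measurable_cong_sets[OF sets(2) refl]\<close>)
    finally show "distr \<rho> (distr \<nu> borel G) snd = distr \<nu> borel G" using marg(4) by simp
  qed
  then have "W1 (distr \<mu> borel F) (distr \<nu> borel G) \<le> (\<integral>\<^sup>+p. ennreal (dist (fst p) (snd p)) \<partial>\<rho>)"
    unfolding W1_def by (rule INF_lower)
  also have "\<dots> = (\<integral>\<^sup>+p. ennreal (dist (F (fst p)) (G (snd p))) \<partial>\<pi>)"
    unfolding \<rho>_def by (subst nn_integral_distr[OF h]) auto
  finally show ?thesis .
qed

lemma mean_field_force_distr:
  assumes g: "g \<in> measurable P \<mu>" "distr P \<mu> g = \<mu>"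
    and m: "(\<lambda>\<omega>'. \<phi> (norm (X (g \<omega>) - X \<omega>')) *\<^sub>R (V \<omega>' - V (g \<omega>))) \<in> borel_measurable \<mu>"
  shows "mean_field_force \<kappa> \<phi> P (\<lambda>p. X (g p)) (\<lambda>p. V (g p)) \<omega> = mean_field_force \<kappa> \<phi> \<mu> X V (g \<omega>)"
  unfolding mean_field_force_def using integral_distr[OF g(1) m] by (simp add: g(2))

lemma integrable_marginal:
  fixes h :: "'a \<Rightarrow> 'b::{banach, second_countable_topology}"
  assumes "g \<in> measurable P \<mu>" "distr P \<mu> g = \<mu>" "integrable \<mu> h"
  shows "integrable P (\<lambda>p. h (g p))"
  using integrable_distr[OF assms(1), of h] assms(2,3) by simp

lemma AE_marginal:
  assumes "g \<in> measurable P \<mu>" "distr P \<mu> g = \<mu>" "AE z in \<mu>. Q z"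
  shows "AE p in P. Q (g p)"
proof (rule AE_distrD[OF assms(1)])
  show "AE z in distr P \<mu> g. Q z" unfolding assms(2) by (rule assms(3))
qed

text \<open>Any coupling of the initial laws is a probability space on which both flows live, as functions
  of the first and of the second coordinate, and the force of either flow computed there is the
  force computed from its own marginal. The bound for a single coupling is affine in its cost with
  constants that do not depend on it, so it passes to the infimum.\<close>
lemma mean_field_flow_W1_stability:
  fixes \<phi> :: "real \<Rightarrow> real" and K L \<kappa> a R0 T :: real
    and \<mu> \<nu> :: "('a::euclidean_space \<times> 'a) measure" and W :: "'a \<times> 'a \<Rightarrow> real"
  defines "E \<equiv> \<integral>z. exp (a * W z) \<partial>\<nu>" and "lam \<equiv> 12 * \<kappa> * L / a"
  defines "A \<equiv> 2 * exp ((1 + 3 * \<kappa> * K) * T) * exp (a / 2 * R0)"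
    and "B \<equiv> 2 * exp ((1 + 3 * \<kappa> * K) * T) * ((T + 1) * (2 * \<kappa> * K * E / a) * exp (- (a / 2) * R0 * exp (- lam * T)))"
  assumes phi: "\<And>r. r \<ge> 0 \<Longrightarrow> 0 \<le> \<phi> r \<and> \<phi> r \<le> K"
    and lip: "\<And>r s. r \<ge> 0 \<Longrightarrow> s \<ge> 0 \<Longrightarrow> \<bar>\<phi> r - \<phi> s\<bar> \<le> L * \<bar>r - s\<bar>"
    and K: "K > 0" and L: "L > 0" and kappa: "\<kappa> > 0" and a: "a > 0" and R0: "R0 \<ge> 0" and T: "T > 0"
    and prob: "prob_space \<mu>" "prob_space \<nu>" and sets: "sets \<mu> = sets borel" "sets \<nu> = sets borel"
    and flow: "mean_field_flow \<kappa> \<phi> T \<mu> \<Psi>" "mean_field_flow \<kappa> \<phi> T \<nu> \<Phi>"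
    and W: "AE z in \<nu>. \<forall>t\<in>{0..T}. norm (snd (\<Phi> t z)) \<le> W z"
    and Wint: "integrable \<nu> (\<lambda>z. exp (a * W z))"
    and t: "t \<in> {0..T}"
  shows "W1 (distr \<mu> borel (\<Psi> t)) (distr \<nu> borel (\<Phi> t)) \<le> ennreal A * W1 \<mu> \<nu> + ennreal B"
proof -
  have E0: "0 \<le> E" unfolding E_def by (intro integral_nonneg_AE) auto
  have proj: "(fst :: 'a \<times> 'a \<Rightarrow> 'a) \<in> borel_measurable borel" "(snd :: 'a \<times> 'a \<Rightarrow> 'a) \<in> borel_measurable borel"
    by (intro borel_measurable_continuous_onI continuous_on_fst continuous_on_snd continuous_on_id)+
  have snd_le: "norm (snd z) \<le> norm z" for z :: "'a \<times> 'a"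
    by (cases z) (simp add: norm_snd_le)
  have AB: "A > 0" "B \<ge> 0" using T kappa K a E0 by (auto simp: A_def B_def)
  have key: "W1 (distr \<mu> borel (\<Psi> t)) (distr \<nu> borel (\<Phi> t))
      \<le> ennreal A * (\<integral>\<^sup>+p. ennreal (dist (fst p) (snd p)) \<partial>\<pi>) + ennreal B"
    if pi: "\<pi> \<in> couplings \<mu> \<nu>" for \<pi>
  proof -
    note marg = coupling_marginals[OF pi]
    interpret prob_space \<pi>
      by (rule prob_space_distrD[OF marg(1)]) (simp add: marg(3) prob)
    have m1[measurable]: "fst \<in> borel_measurable \<pi>" using marg(1) by (simp add: measurable_cong_sets[OF refl sets(1)])
    have m2[measurable]: "snd \<in> borel_measurable \<pi>" using marg(2) by (simp add: measurable_cong_sets[OF refl sets(2)])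
    have Pm: "\<Psi> s \<in> borel_measurable borel" "\<Phi> s \<in> borel_measurable borel" if "s \<in> {0..T}" for s
      using flow that by (auto simp: mean_field_flow_def)
    have fm: "(\<lambda>p. \<Psi> s (fst p)) \<in> borel_measurable \<pi>" "(\<lambda>p. \<Phi> s (snd p)) \<in> borel_measurable \<pi>"
      if "s \<in> {0..T}" for s
      using measurable_compose[OF m1 Pm(1)[OF that]] measurable_compose[OF m2 Pm(2)[OF that]] .
    obtain G H where G: "integrable \<mu> G" "AE z in \<mu>. \<forall>t\<in>{0..T}. norm (\<Psi> t z) \<le> G z"
      and H: "integrable \<nu> H" "AE z in \<nu>. \<forall>t\<in>{0..T}. norm (\<Phi> t z) \<le> H z"
      using flow unfolding mean_field_flow_def by blast
    have iG: "integrable \<pi> (\<lambda>p. G (fst p))" by (rule integrable_marginal[OF marg(1,3) G(1)])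
    have iH: "integrable \<pi> (\<lambda>p. H (snd p))" by (rule integrable_marginal[OF marg(2,4) H(1)])
    have bG: "AE p in \<pi>. \<forall>t\<in>{0..T}. norm (\<Psi> t (fst p)) \<le> G (fst p)"
      by (rule AE_marginal[OF marg(1,3) G(2)])
    have bH: "AE p in \<pi>. \<forall>t\<in>{0..T}. norm (\<Phi> t (snd p)) \<le> H (snd p)"
      by (rule AE_marginal[OF marg(2,4) H(2)])
    define e where "e s p = dist (\<Psi> s (fst p)) (\<Phi> s (snd p))" for s p
    have be: "AE p in \<pi>. e s p \<le> G (fst p) + H (snd p)" if "s \<in> {0..T}" for s
      using bG bH
    proof eventually_elim
      case (elim p)
      have "e s p \<le> norm (\<Psi> s (fst p)) + norm (\<Phi> s (snd p))"
        unfolding e_def dist_norm by (rule norm_triangle_ineq4)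
      then show ?case using elim that by force
    qed
    have em: "e s \<in> borel_measurable \<pi>" if "s \<in> {0..T}" for s
      unfolding e_def[abs_def] using fm[OF that] by measurable
    have ie: "integrable \<pi> (e s)" if s: "s \<in> {0..T}" for s
    proof (rule Bochner_Integration.integrable_bound[OF Bochner_Integration.integrable_add[OF iG iH] em[OF s]])
      show "AE p in \<pi>. norm (e s p) \<le> norm (G (fst p) + H (snd p))"
        using be[OF s] by eventually_elim (simp add: e_def)
    qed
    have Db: "(\<integral>p. e s p \<partial>\<pi>) \<le> (\<integral>p. G (fst p) + H (snd p) \<partial>\<pi>)" if s: "s \<in> {0..T}" for s
      by (rule integral_mono_AE[OF ie[OF s] Bochner_Integration.integrable_add[OF iG iH] be[OF s]])
    have ivel1: "integrable \<pi> (\<lambda>p. snd (\<Psi> s (fst p)))" if s: "s \<in> {0..T}" for s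
    proof (rule Bochner_Integration.integrable_bound[OF iG])
      show "(\<lambda>p. snd (\<Psi> s (fst p))) \<in> borel_measurable \<pi>"
        by (rule measurable_compose[OF fm(1)[OF s] proj(2)])
      show "AE p in \<pi>. norm (snd (\<Psi> s (fst p))) \<le> norm (G (fst p))"
        using bG
      proof eventually_elim
        case (elim p)
        then have "norm (\<Psi> s (fst p)) \<le> G (fst p)" using s by blast
        then show ?case using snd_le[of "\<Psi> s (fst p)"] by simp
      qed
    qed
    have ivel2: "integrable \<pi> (\<lambda>p. snd (\<Phi> s (snd p)))" if s: "s \<in> {0..T}" for s
    proof (rule Bochner_Integration.integrable_bound[OF iH])
      show "(\<lambda>p. snd (\<Phi> s (snd p))) \<in> borel_measurable \<pi>"
        by (rule measurable_compose[OF fm(2)[OF s] proj(2)])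
      show "AE p in \<pi>. norm (snd (\<Phi> s (snd p))) \<le> norm (H (snd p))"
        using bH
      proof eventually_elim
        case (elim p)
        then have "norm (\<Phi> s (snd p)) \<le> H (snd p)" using s by blast
        then show ?case using snd_le[of "\<Phi> s (snd p)"] by simp
      qed
    qed
    have pos1: "(\<lambda>p. fst (\<Psi> s (fst p))) \<in> borel_measurable \<pi>" "(\<lambda>p. fst (\<Phi> s (snd p))) \<in> borel_measurable \<pi>"
      if s: "s \<in> {0..T}" for s
      by (rule measurable_compose[OF fm(1)[OF s] proj(1)], rule measurable_compose[OF fm(2)[OF s] proj(1)])
    have fmeas: "(\<lambda>z'. \<phi> (norm (fst (F s z) - fst (F s z'))) *\<^sub>R (snd (F s z') - snd (F s z))) \<in> borel_measurable borel"
      if Fs: "F s \<in> borel_measurable borel" for F :: "real \<Rightarrow> 'a \<times> 'a \<Rightarrow> 'a \<times> 'a" and s z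
    proof -
      have 1: "(\<lambda>z'. fst (F s z')) \<in> borel_measurable borel"
        by (rule measurable_compose[OF Fs proj(1)])
      have 2: "(\<lambda>z'. snd (F s z')) \<in> borel_measurable borel"
        by (rule measurable_compose[OF Fs proj(2)])
      show ?thesis
        by (intro borel_measurable_scaleR borel_measurable_diff kernel_measurable[OF phi lip K L kappa] 1 2) auto
    qed
    have force1: "mean_field_force \<kappa> \<phi> \<pi> (\<lambda>p. fst (\<Psi> s (fst p))) (\<lambda>p. snd (\<Psi> s (fst p))) p
        = mean_field_force \<kappa> \<phi> \<mu> (\<lambda>z. fst (\<Psi> s z)) (\<lambda>z. snd (\<Psi> s z)) (fst p)" if s: "s \<in> {0..T}" for s p
      by (rule mean_field_force_distr[OF marg(1,3), where X = "\<lambda>z. fst (\<Psi> s z)" and V = "\<lambda>z. snd (\<Psi> s z)"])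
         (use fmeas[of \<Psi>, OF Pm(1)[OF s]] in \<open>simp add: measurable_cong_sets[OF sets(1) refl]\<close>)
    have force2: "mean_field_force \<kappa> \<phi> \<pi> (\<lambda>p. fst (\<Phi> s (snd p))) (\<lambda>p. snd (\<Phi> s (snd p))) p
        = mean_field_force \<kappa> \<phi> \<nu> (\<lambda>z. fst (\<Phi> s z)) (\<lambda>z. snd (\<Phi> s z)) (snd p)" if s: "s \<in> {0..T}" for s p
      by (rule mean_field_force_distr[OF marg(2,4), where X = "\<lambda>z. fst (\<Phi> s z)" and V = "\<lambda>z. snd (\<Phi> s z)"])
         (use fmeas[of \<Phi>, OF Pm(2)[OF s]] in \<open>simp add: measurable_cong_sets[OF sets(2) refl]\<close>)
    have Eeq: "(\<integral>p. exp (a * W (snd p)) \<partial>\<pi>) = E"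
      unfolding E_def using integral_distr[OF marg(2), of "\<lambda>z. exp (a * W z)"] Wint by (simp add: marg(4))
    have stab: "(\<integral>p. e t p \<partial>\<pi>) \<le> 2 * exp ((1 + 3 * \<kappa> * K) * T) *
      (exp (a / 2 * R0) * (\<integral>p. e 0 p \<partial>\<pi>) + (T + 1) * (2 * \<kappa> * K * E / a) * exp (- (a / 2) * R0 * exp (- lam * T)))"
    proof -
      have ODE: "AE z in \<mu>. \<forall>t\<in>{0..T}. ((\<lambda>t. fst (\<Psi> t z)) has_vector_derivative snd (\<Psi> t z)) (at t within {0..T})"
         "AE z in \<mu>. \<forall>t\<in>{0..T}. ((\<lambda>t. snd (\<Psi> t z)) has_vector_derivative
            mean_field_force \<kappa> \<phi> \<mu> (\<lambda>z. fst (\<Psi> t z)) (\<lambda>z. snd (\<Psi> t z)) z) (at t within {0..T})"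
         "AE z in \<nu>. \<forall>t\<in>{0..T}. ((\<lambda>t. fst (\<Phi> t z)) has_vector_derivative snd (\<Phi> t z)) (at t within {0..T})"
         "AE z in \<nu>. \<forall>t\<in>{0..T}. ((\<lambda>t. snd (\<Phi> t z)) has_vector_derivative
            mean_field_force \<kappa> \<phi> \<nu> (\<lambda>z. fst (\<Phi> t z)) (\<lambda>z. snd (\<Phi> t z)) z) (at t within {0..T})"
        using flow by (auto simp: mean_field_flow_def)
      note lifted = AE_marginal[OF marg(1,3) ODE(1)] AE_marginal[OF marg(1,3) ODE(2)]
        AE_marginal[OF marg(2,4) ODE(3)] AE_marginal[OF marg(2,4) ODE(4)]
      have e_eq: "e s = (\<lambda>p. dist (fst (\<Psi> s (fst p)), snd (\<Psi> s (fst p))) (fst (\<Phi> s (snd p)), snd (\<Phi> s (snd p))))" for s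
        by (simp add: e_def fun_eq_iff)
      show ?thesis
        unfolding e_eq Eeq[symmetric] lam_def
      proof (rule mean_field_stability[OF phi lip K L kappa a R0 T prob_space_axioms, where W = "\<lambda>p. W (snd p)"])
        show "integrable \<pi> (\<lambda>p. exp (a * W (snd p)))" by (rule integrable_marginal[OF marg(2,4) Wint])
        show "AE p in \<pi>. \<forall>t\<in>{0..T}. norm (snd (\<Phi> t (snd p))) \<le> W (snd p)" by (rule AE_marginal[OF marg(2,4) W])
      qed (use pos1 ivel1 ivel2 ie[unfolded e_eq] Db[unfolded e_eq] lifted t in \<open>simp_all add: force1 force2 cong: ball_cong_simp\<close>)
    qed
    have init: "AE p in \<pi>. e 0 p = dist (fst p) (snd p)"
    proof -
      have "AE z in \<mu>. \<Psi> 0 z = z" "AE z in \<nu>. \<Phi> 0 z = z" using flow by (auto simp: mean_field_flow_def)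
      from AE_marginal[OF marg(1,3) this(1)] AE_marginal[OF marg(2,4) this(2)] show ?thesis
        by eventually_elim (simp add: e_def)
    qed
    have nn: "(\<integral>\<^sup>+p. ennreal (e s p) \<partial>\<pi>) = ennreal (\<integral>p. e s p \<partial>\<pi>)" if "s \<in> {0..T}" for s
      by (rule nn_integral_eq_integral[OF ie[OF that]]) (simp add: e_def)
    have D0: "0 \<le> (\<integral>p. e 0 p \<partial>\<pi>)" by (intro integral_nonneg_AE) (simp add: e_def)
    have "W1 (distr \<mu> borel (\<Psi> t)) (distr \<nu> borel (\<Phi> t)) \<le> (\<integral>\<^sup>+p. ennreal (e t p) \<partial>\<pi>)"
      unfolding e_def by (rule W1_distr_le[OF pi sets Pm[OF t]])
    also have "\<dots> \<le> ennreal (A * (\<integral>p. e 0 p \<partial>\<pi>) + B)"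
      unfolding nn[OF t] using stab by (intro ennreal_leI) (simp add: A_def B_def algebra_simps)
    also have "\<dots> = ennreal A * (\<integral>\<^sup>+p. ennreal (e 0 p) \<partial>\<pi>) + ennreal B"
      using AB D0 T by (simp add: nn ennreal_plus ennreal_mult)
    also have "(\<integral>\<^sup>+p. ennreal (e 0 p) \<partial>\<pi>) = (\<integral>\<^sup>+p. ennreal (dist (fst p) (snd p)) \<partial>\<pi>)"
      by (rule nn_integral_cong_AE) (use init in eventually_elim, simp)
    finally show ?thesis .
  qed
  show ?thesis
    unfolding ennreal_le_affine_iff[OF AB] W1_def[of \<mu> \<nu>]
    by (rule INF_greatest) (use key in \<open>simp add: ennreal_le_affine_iff[OF AB]\<close>)
qed

section \<open>The particle system as a mean-field flow\<close>

lemma measurable_uniform_count_measure_borel: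
  "z0 \<in> measurable (uniform_count_measure {1..N::nat}) borel"
  by (auto simp: measurable_def sets_uniform_count_measure space_uniform_count_measure)

lemma integral_empirical:
  fixes h :: "'a::topological_space \<Rightarrow> 'b::euclidean_space"
  assumes "h \<in> borel_measurable borel"
  shows "(\<integral>z. h z \<partial>empirical N z0) = (1 / real N) *\<^sub>R (\<Sum>i=1..N. h (z0 i))"
proof -
  have "(\<integral>z. h z \<partial>empirical N z0) = (\<integral>i. h (z0 i) \<partial>uniform_count_measure {1..N})"
    unfolding empirical_def
    by (rule integral_distr[OF measurable_uniform_count_measure_borel assms])
  also have "\<dots> = (\<Sum>i=1..N. (1 / real N) *\<^sub>R h (z0 i))"
    unfolding uniform_count_measure_def by (subst lebesgue_integral_point_measure_finite) auto
  finally show ?thesis by (simp add: scaleR_sum_right)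
qed

lemma AE_empirical_range:
  fixes z0 :: "nat \<Rightarrow> 'a::t1_space"
  shows "AE z in empirical N z0. z \<in> z0 ` {1..N}"
proof -
  note m = measurable_uniform_count_measure_borel[of z0 N]
  have "z0 ` {1..N} \<in> sets borel" by (intro borel_closed finite_imp_closed) auto
  then show ?thesis
    unfolding empirical_def
    by (subst AE_distr_iff[OF m]) (auto intro!: AE_I2 simp: space_uniform_count_measure)
qed

lemma prob_space_empirical: "N \<ge> 1 \<Longrightarrow> prob_space (empirical N z0)"
  unfolding empirical_def
  by (intro prob_space.prob_space_distr prob_space_uniform_count_measure)
     (auto intro: measurable_uniform_count_measure_borel)

context
  fixes \<phi> :: "real \<Rightarrow> real" and K L \<kappa> :: real and N :: nat
    and z0 :: "nat \<Rightarrow> (real^'d) \<times> (real^'d)" and x v :: "nat \<Rightarrow> real \<Rightarrow> real^'d"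
  assumes phi: "\<And>r. r \<ge> 0 \<Longrightarrow> 0 \<le> \<phi> r \<and> \<phi> r \<le> K"
    and lip: "\<And>r s. r \<ge> 0 \<Longrightarrow> s \<ge> 0 \<Longrightarrow> \<bar>\<phi> r - \<phi> s\<bar> \<le> L * \<bar>r - s\<bar>"
    and K: "K > 0" and L: "L > 0" and kappa: "\<kappa> > 0" and N: "N \<ge> 1"
    and particles: "CS_particles \<kappa> \<phi> N z0 x v"
begin

lemma particle_deriv:
  assumes "i \<in> {1..N}" "t \<in> {0..T}"
  shows "(x i has_vector_derivative v i t) (at t within {0..T})"
    "(v i has_vector_derivative
        (\<kappa> / real N) *\<^sub>R (\<Sum>j=1..N. \<phi> (norm (x i t - x j t)) *\<^sub>R (v j t - v i t))) (at t within {0..T})"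
  using assms particles unfolding CS_particles_def
  by (auto intro!: has_vector_derivative_within_subset[where S = "{0..}" and T = "{0..T}"])

lemma particles_bounded:
  obtains C where "C \<ge> 0" "\<And>i t. i \<in> {1..N} \<Longrightarrow> t \<in> {0..T} \<Longrightarrow> norm (x i t, v i t) \<le> C"
proof -
  have "\<exists>c. \<forall>t\<in>{0..T}. norm (x i t, v i t) \<le> c" if i: "i \<in> {1..N}" for i
  proof -
    have "continuous_on {0..T} (\<lambda>t. (x i t, v i t))"
    proof (intro continuous_on_Pair)
      show "continuous_on {0..T} (x i)" "continuous_on {0..T} (v i)"
        using particle_deriv[OF i, of _ T] has_vector_derivative_continuous
        unfolding continuous_on_eq_continuous_within by blast+
    qed
    then have "bounded ((\<lambda>t. (x i t, v i t)) ` {0..T})"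
      by (intro compact_imp_bounded compact_continuous_image) auto
    then show ?thesis by (auto simp: bounded_iff)
  qed
  then obtain c where c: "\<And>i t. i \<in> {1..N} \<Longrightarrow> t \<in> {0..T} \<Longrightarrow> norm (x i t, v i t) \<le> c i" by metis
  show ?thesis
  proof (rule that[of "\<Sum>i=1..N. \<bar>c i\<bar>"])
    fix i t assume it: "i \<in> {1..N}" "t \<in> {0..T}"
    have "norm (x i t, v i t) \<le> \<bar>c i\<bar>" using c[OF it] by linarith
    also have "\<dots> \<le> (\<Sum>i=1..N. \<bar>c i\<bar>)" using it by (intro member_le_sum) auto
    finally show "norm (x i t, v i t) \<le> (\<Sum>i=1..N. \<bar>c i\<bar>)" .
  qed (simp add: sum_nonneg)
qed

text \<open>Different indices may share an initial point, so the particle trajectories define a map on phase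
  space only if such particles never separate. Along the trajectories, which are bounded on
  compact time intervals, the force is Lipschitz in the state of the particle it acts on, which
  gives uniqueness.\<close>
lemma particles_determined_by_initial:
  assumes ij: "i \<in> {1..N}" "j \<in> {1..N}" "z0 i = z0 j" and t: "t \<ge> 0"
  shows "(x i t, v i t) = (x j t, v j t)"
proof -
  obtain C where C: "C \<ge> 0" "\<And>i s. i \<in> {1..N} \<Longrightarrow> s \<in> {0..t} \<Longrightarrow> norm (x i s, v i s) \<le> C"
    by (rule particles_bounded[of t]) blast
  define b where "b = 1 + \<kappa> * (K + L * (2 * C))"
  define F where "F i s = (\<kappa> / real N) *\<^sub>R (\<Sum>k=1..N. \<phi> (norm (x i s - x k s)) *\<^sub>R (v k s - v i s))" for i s
  let ?w = "\<lambda>s. (x i s - x j s, v i s - v j s)"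
  let ?w' = "\<lambda>s. (v i s - v j s, F i s - F j s)"
  have "norm (?w t) \<le> 0"
  proof (rule norm_le_by_comparison[where w = ?w and w' = ?w' and y = "\<lambda>_. 0" and y' = "\<lambda>_. 0"
        and b = "\<lambda>_. b" and B = "\<lambda>s. b * s" and g = "\<lambda>_. 0" and T = t and t = t])
    fix s assume s: "s \<in> {0..t}"
    show "(?w has_vector_derivative ?w' s) (at s within {0..t})"
      unfolding F_def using ij s by (intro has_vector_derivative_Pair has_vector_derivative_diff particle_deriv) auto
    have x: "norm (x i s - x j s) \<le> norm (?w s)" and v: "norm (v i s - v j s) \<le> norm (?w s)"
      by (rule norm_fst_le, rule norm_snd_le)
    have "norm (F i s - F j s) = (\<kappa> / real N) * norm (\<Sum>k=1..N. \<phi> (norm (x i s - x k s)) *\<^sub>R (v k s - v i s)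
        - \<phi> (norm (x j s - x k s)) *\<^sub>R (v k s - v j s))"
      unfolding F_def using kappa by (simp add: sum_subtractf flip: scaleR_diff_right)
    also have "\<dots> \<le> (\<kappa> / real N) * (\<Sum>k=1..N. (K + L * (2 * C)) * norm (?w s))"
    proof (intro mult_left_mono sum_norm_le)
      fix k assume k: "k \<in> {1..N}"
      have p: "0 \<le> \<phi> (norm (x i s - x k s))" "\<phi> (norm (x i s - x k s)) \<le> K"
        using phi by auto
      have "\<bar>\<phi> (norm (x i s - x k s)) - \<phi> (norm (x j s - x k s))\<bar>
          \<le> L * \<bar>norm (x i s - x k s) - norm (x j s - x k s)\<bar>" by (rule lip) auto
      also have "\<dots> \<le> L * norm ((x i s - x k s) - (x j s - x k s))"
        using L by (intro mult_left_mono norm_triangle_ineq3) auto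
      also have "\<dots> \<le> L * norm (?w s)" using x L by simp
      finally have q: "\<bar>\<phi> (norm (x i s - x k s)) - \<phi> (norm (x j s - x k s))\<bar> \<le> L * norm (?w s)" .
      have "norm (v k s) \<le> C" "norm (v j s) \<le> C"
        using C(2)[OF k s] C(2)[OF ij(2) s] norm_snd_le[of "v k s" "x k s"] norm_snd_le[of "v j s" "x j s"]
        by linarith+
      then have r: "norm (v k s - v j s) \<le> 2 * C" using norm_triangle_ineq4[of "v k s" "v j s"] by linarith
      have "\<phi> (norm (x i s - x k s)) *\<^sub>R (v k s - v i s) - \<phi> (norm (x j s - x k s)) *\<^sub>R (v k s - v j s)
          = (\<phi> (norm (x i s - x k s)) - \<phi> (norm (x j s - x k s))) *\<^sub>R (v k s - v j s)
            - \<phi> (norm (x i s - x k s)) *\<^sub>R (v i s - v j s)"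
        by (simp add: algebra_simps)
      also have "norm \<dots> \<le> \<bar>\<phi> (norm (x i s - x k s)) - \<phi> (norm (x j s - x k s))\<bar> * norm (v k s - v j s)
            + \<phi> (norm (x i s - x k s)) * norm (v i s - v j s)"
        using p by (intro order_trans[OF norm_triangle_ineq4]) simp
      also have "\<dots> \<le> L * norm (?w s) * (2 * C) + K * norm (?w s)"
        using p q r v L K C by (intro add_mono mult_mono) auto
      finally show "norm (\<phi> (norm (x i s - x k s)) *\<^sub>R (v k s - v i s) - \<phi> (norm (x j s - x k s)) *\<^sub>R (v k s - v j s))
         \<le> (K + L * (2 * C)) * norm (?w s)"
        by (simp add: algebra_simps)
    qed (use kappa in auto)
    also have "\<dots> = \<kappa> * (K + L * (2 * C)) * norm (?w s)" using N by simp
    finally have F: "norm (F i s - F j s) \<le> \<kappa> * (K + L * (2 * C)) * norm (?w s)" .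
    have "?w s \<bullet> ?w' s \<le> norm (?w s) * norm (?w' s)" by (rule norm_cauchy_schwarz)
    also have "norm (?w' s) \<le> norm (v i s - v j s) + norm (F i s - F j s)" by (rule norm_Pair_le)
    also have "\<dots> \<le> norm (?w s) + \<kappa> * (K + L * (2 * C)) * norm (?w s)" by (intro add_mono F v)
    also have "\<dots> = b * norm (?w s) + 0" by (simp add: b_def algebra_simps)
    finally show "?w s \<bullet> ?w' s \<le> norm (?w s) * (b * norm (?w s) + 0)" by (simp add: mult_left_mono)
  next
    have "(x i 0, v i 0) = (x j 0, v j 0)" using ij particles by (simp add: CS_particles_def)
    then show "norm (?w 0) \<le> 0" by simp
  qed (use t kappa K L C(1) in \<open>auto simp: b_def intro!: derivative_eq_intros\<close>)
  then have "?w t = 0" by (simp only: norm_le_zero_iff)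
  then show ?thesis by (simp add: zero_prod_def)
qed

text \<open>Points at which no particle starts form a null set of the empirical measure; the value 0 there
  keeps the map measurable and bounded.\<close>
definition particle_flow :: "real \<Rightarrow> (real^'d) \<times> (real^'d) \<Rightarrow> (real^'d) \<times> (real^'d)" where
  "particle_flow t z = (if z \<in> z0 ` {1..N} then (let i = (SOME i. i \<in> {1..N} \<and> z0 i = z) in (x i t, v i t)) else 0)"

lemma particle_flow_eq:
  assumes "i \<in> {1..N}" "t \<ge> 0"
  shows "particle_flow t (z0 i) = (x i t, v i t)"
proof -
  define k where "k = (SOME k. k \<in> {1..N} \<and> z0 k = z0 i)"
  have "k \<in> {1..N} \<and> z0 k = z0 i" unfolding k_def by (rule someI[of _ i]) (use assms in auto)
  then have "(x k t, v k t) = (x i t, v i t)"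
    using particles_determined_by_initial assms by blast
  then show ?thesis using assms by (simp add: particle_flow_def k_def)
qed

lemma particle_flow_measurable: "particle_flow t \<in> borel_measurable borel"
proof (rule measurable_discrete_difference[where f = "\<lambda>_. 0" and X = "z0 ` {1..N}"])
  show "countable (z0 ` {1..N})" by auto
qed (auto simp: particle_flow_def)

lemma distr_particle_flow:
  assumes "t \<ge> 0"
  shows "distr (empirical N z0) borel (particle_flow t) = empirical N (\<lambda>i. (x i t, v i t))"
proof -
  note m = measurable_uniform_count_measure_borel[of z0 N]
  show ?thesis
    unfolding empirical_def distr_distr[OF particle_flow_measurable m]
    using particle_flow_eq assms by (intro distr_cong) (auto simp: space_uniform_count_measure)
qed

lemma mean_field_flow_particles: "mean_field_flow \<kappa> \<phi> T (empirical N z0) particle_flow"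
  unfolding mean_field_flow_def
proof (intro conjI ballI)
  let ?\<mu> = "empirical N z0"
  interpret prob_space ?\<mu> by (rule prob_space_empirical[OF N])
  obtain C where C: "C \<ge> 0" "\<And>i s. i \<in> {1..N} \<Longrightarrow> s \<in> {0..T} \<Longrightarrow> norm (x i s, v i s) \<le> C"
    by (rule particles_bounded[of T]) blast
  have proj: "(\<lambda>z. fst (particle_flow t z)) \<in> borel_measurable borel" "(\<lambda>z. snd (particle_flow t z)) \<in> borel_measurable borel" for t
    by (intro measurable_compose[OF particle_flow_measurable] borel_measurable_continuous_onI
        continuous_on_fst continuous_on_snd continuous_on_id)+
  show "particle_flow t \<in> borel_measurable borel" for t by (rule particle_flow_measurable)
  show "AE z in ?\<mu>. particle_flow 0 z = z"
    using AE_empirical_range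
  proof eventually_elim
    case (elim z)
    then obtain i where "i \<in> {1..N}" "z = z0 i" by blast
    then show ?case using particle_flow_eq[of i 0] particles by (simp add: CS_particles_def)
  qed
  show "AE z in ?\<mu>. \<forall>t\<in>{0..T}. ((\<lambda>t. fst (particle_flow t z)) has_vector_derivative snd (particle_flow t z)) (at t within {0..T})"
    using AE_empirical_range
  proof eventually_elim
    case (elim z)
    then obtain i where i: "i \<in> {1..N}" "z = z0 i" by blast
    show ?case
    proof
      fix t assume t: "t \<in> {0..T}"
      show "((\<lambda>t. fst (particle_flow t z)) has_vector_derivative snd (particle_flow t z)) (at t within {0..T})"
        using has_vector_derivative_transform[OF t _ particle_deriv(1)[OF i(1) t], of "\<lambda>t. fst (particle_flow t z)"]
          particle_flow_eq[OF i(1)] i(2) t by simp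
    qed
  qed
  show "AE z in ?\<mu>. \<forall>t\<in>{0..T}. ((\<lambda>t. snd (particle_flow t z)) has_vector_derivative
        mean_field_force \<kappa> \<phi> ?\<mu> (\<lambda>z. fst (particle_flow t z)) (\<lambda>z. snd (particle_flow t z)) z) (at t within {0..T})"
    using AE_empirical_range
  proof eventually_elim
    case (elim z)
    then obtain i where i: "i \<in> {1..N}" "z = z0 i" by blast
    show ?case
    proof
      fix t assume t: "t \<in> {0..T}"
      have "mean_field_force \<kappa> \<phi> ?\<mu> (\<lambda>z. fst (particle_flow t z)) (\<lambda>z. snd (particle_flow t z)) z
        = (\<kappa> / real N) *\<^sub>R (\<Sum>j=1..N. \<phi> (norm (x i t - x j t)) *\<^sub>R (v j t - v i t))"
        unfolding mean_field_force_def
        using i t particle_flow_eq proj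
        by (subst integral_empirical)
          (auto intro!: borel_measurable_scaleR borel_measurable_diff kernel_measurable[OF phi lip K L kappa] sum.cong)
      moreover have "((\<lambda>t. snd (particle_flow t z)) has_vector_derivative
          (\<kappa> / real N) *\<^sub>R (\<Sum>j=1..N. \<phi> (norm (x i t - x j t)) *\<^sub>R (v j t - v i t))) (at t within {0..T})"
        using has_vector_derivative_transform[OF t _ particle_deriv(2)[OF i(1) t], of "\<lambda>t. snd (particle_flow t z)"]
          particle_flow_eq[OF i(1)] i(2) t by simp
      ultimately show "((\<lambda>t. snd (particle_flow t z)) has_vector_derivative
          mean_field_force \<kappa> \<phi> ?\<mu> (\<lambda>z. fst (particle_flow t z)) (\<lambda>z. snd (particle_flow t z)) z) (at t within {0..T})"
        by simp
    qed
  qed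
  show "\<exists>G. integrable ?\<mu> G \<and> (AE z in ?\<mu>. \<forall>t\<in>{0..T}. norm (particle_flow t z) \<le> G z)"
  proof (intro exI[of _ "\<lambda>_. C"] conjI)
    show "AE z in ?\<mu>. \<forall>t\<in>{0..T}. norm (particle_flow t z) \<le> C"
      using AE_empirical_range by eventually_elim (use C particle_flow_eq in auto)
  qed simp
qed

end

section \<open>The kinetic solution as a mean-field flow\<close>

lemma prob_space_density_lborel:
  fixes g :: "'a::euclidean_space \<Rightarrow> real"
  assumes "integrable lborel g" "AE z in lborel. 0 \<le> g z" "(LINT z|lborel. g z) = 1"
  shows "prob_space (density lborel (\<lambda>z. ennreal (g z)))"
proof
  have "g \<in> borel_measurable lborel" using assms(1) by (rule borel_measurable_integrable)
  then have "emeasure (density lborel (\<lambda>z. ennreal (g z))) UNIV = (\<integral>\<^sup>+z. ennreal (g z) \<partial>lborel)"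
    by (subst emeasure_density) auto
  also have "\<dots> = 1" using nn_integral_eq_integral[OF assms(1,2)] assms(3) by simp
  finally show "emeasure (density lborel (\<lambda>z. ennreal (g z))) (space (density lborel (\<lambda>z. ennreal (g z)))) = 1" by simp
qed

text \<open>A density enters a measure through its positive part only. If the positive part already carries
  the whole integral, the negative part has integral 0.\<close>
lemma AE_nonneg_of_equal_mass:
  fixes g :: "'a \<Rightarrow> real"
  assumes g: "integrable M g" and 1: "(\<integral>\<^sup>+z. ennreal (g z) \<partial>M) = ennreal (\<integral>z. g z \<partial>M)"
    and 0: "0 \<le> (\<integral>z. g z \<partial>M)"
  shows "AE z in M. 0 \<le> g z"
proof -
  have fin: "(\<integral>\<^sup>+z. ennreal (- g z) \<partial>M) \<noteq> \<top>"
    using g by (simp add: real_integrable_def)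
  have "enn2real (\<integral>\<^sup>+z. ennreal (- g z) \<partial>M) = 0"
    using real_lebesgue_integral_def[OF g] 0 unfolding 1 by simp
  then have "(\<integral>\<^sup>+z. ennreal (- g z) \<partial>M) = 0"
    using fin by (simp add: enn2real_eq_0_iff)
  then have "AE z in M. ennreal (- g z) = 0"
    using borel_measurable_integrable[OF g] by (subst (asm) nn_integral_0_iff_AE) auto
  then show ?thesis by eventually_elim (auto simp: ennreal_eq_0_iff)
qed

lemma norm_le_one_plus_powr:
  assumes "q \<ge> 1" shows "norm u \<le> 1 + norm u powr q"
proof (cases "norm u \<le> 1")
  case True
  then show ?thesis by (simp add: add_increasing2)
next
  case False
  then have "norm u powr 1 \<le> norm u powr q" using assms by (intro powr_mono) auto
  then show ?thesis using False by simp
qed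

context
  fixes \<phi> :: "real \<Rightarrow> real" and K L \<kappa> :: real
    and f0 :: "(real^'d) \<times> (real^'d) \<Rightarrow> real" and f :: "real \<Rightarrow> (real^'d) \<times> (real^'d) \<Rightarrow> real"
    and \<alpha> q :: real
  assumes phi: "\<And>r. r \<ge> 0 \<Longrightarrow> 0 \<le> \<phi> r \<and> \<phi> r \<le> K"
    and lip: "\<And>r s. r \<ge> 0 \<Longrightarrow> s \<ge> 0 \<Longrightarrow> \<bar>\<phi> r - \<phi> s\<bar> \<le> L * \<bar>r - s\<bar>"
    and K: "K > 0" and L: "L > 0" and kappa: "\<kappa> > 0"
    and f0: "integrable lborel f0" "AE z in lborel. 0 \<le> f0 z" "(LINT z|lborel. f0 z) = 1"
    and \<alpha>: "\<alpha> > 0" and q: "q > 2"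
    and moments: "integrable lborel
           (\<lambda>z. (norm (fst z) powr q + norm (snd z) powr q + exp (\<alpha> * norm (snd z))) * f0 z)"
    and sol: "CS_weak_solution \<kappa> \<phi> f0 f"
begin

abbreviation "initial_law \<equiv> density lborel (\<lambda>z. ennreal (f0 z))"

lemma integrable_wrt_initial_law:
  fixes h :: "(real^'d) \<times> (real^'d) \<Rightarrow> real"
  assumes h: "h \<in> borel_measurable borel"
    and bound: "\<And>z. \<bar>h z\<bar> \<le> c * (norm (fst z) powr q + norm (snd z) powr q + exp (\<alpha> * norm (snd z)))"
  shows "integrable initial_law h"
proof -
  have m: "f0 \<in> borel_measurable lborel" using f0(1) by (rule borel_measurable_integrable)
  have "integrable lborel (\<lambda>z. f0 z *\<^sub>R h z)"
  proof (rule Bochner_Integration.integrable_bound[OF integrable_mult_right[OF moments, of c]])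
    show "(\<lambda>z. f0 z *\<^sub>R h z) \<in> borel_measurable lborel" using h m by simp
    show "AE z in lborel. norm (f0 z *\<^sub>R h z)
        \<le> norm (c * ((norm (fst z) powr q + norm (snd z) powr q + exp (\<alpha> * norm (snd z))) * f0 z))"
    proof (rule AE_I2)
      fix z
      have "\<bar>f0 z\<bar> * \<bar>h z\<bar> \<le> \<bar>f0 z\<bar> * \<bar>c * (norm (fst z) powr q + norm (snd z) powr q + exp (\<alpha> * norm (snd z)))\<bar>"
        using order_trans[OF bound abs_ge_self] by (rule mult_left_mono) simp
      then show "norm (f0 z *\<^sub>R h z)
        \<le> norm (c * ((norm (fst z) powr q + norm (snd z) powr q + exp (\<alpha> * norm (snd z))) * f0 z))"
        by (simp add: abs_mult mult_ac)
    qed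
  qed
  then show ?thesis using h m f0(2) by (subst integrable_density) auto
qed

lemma proj_measurable:
  "(\<lambda>z::(real^'d) \<times> (real^'d). norm (fst z)) \<in> borel_measurable borel"
  "(\<lambda>z::(real^'d) \<times> (real^'d). norm (snd z)) \<in> borel_measurable borel"
  "(\<lambda>z::(real^'d) \<times> (real^'d). fst z) \<in> borel_measurable borel"
  "(\<lambda>z::(real^'d) \<times> (real^'d). snd z) \<in> borel_measurable borel"
  by (intro borel_measurable_continuous_onI continuous_intros)+

lemma initial_moments:
  "integrable initial_law (\<lambda>z. norm (fst z))" "integrable initial_law (\<lambda>z. norm (snd z))"
  "integrable initial_law (\<lambda>z. exp (\<alpha> * (norm (snd z) + c)))"
proof -
  have e: "1 \<le> exp (\<alpha> * norm (v::real^'d))" for v using \<alpha> by simp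
  show "integrable initial_law (\<lambda>z. norm (fst z))"
  proof (rule integrable_wrt_initial_law[where c = 1, OF proj_measurable(1)])
    fix z :: "(real^'d) \<times> (real^'d)"
    have "norm (fst z) \<le> 1 + norm (fst z) powr q" using q by (intro norm_le_one_plus_powr) simp
    then show "\<bar>norm (fst z)\<bar> \<le> 1 * (norm (fst z) powr q + norm (snd z) powr q + exp (\<alpha> * norm (snd z)))"
      unfolding mult_1 abs_norm_cancel using e[of "snd z"] powr_ge_zero[of "norm (snd z)" q] by linarith
  qed
  show "integrable initial_law (\<lambda>z. norm (snd z))"
  proof (rule integrable_wrt_initial_law[where c = 1, OF proj_measurable(2)])
    fix z :: "(real^'d) \<times> (real^'d)"
    have "norm (snd z) \<le> 1 + norm (snd z) powr q" using q by (intro norm_le_one_plus_powr) simp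
    then show "\<bar>norm (snd z)\<bar> \<le> 1 * (norm (fst z) powr q + norm (snd z) powr q + exp (\<alpha> * norm (snd z)))"
      unfolding mult_1 abs_norm_cancel using e[of "snd z"] powr_ge_zero[of "norm (fst z)" q] by linarith
  qed
  show "integrable initial_law (\<lambda>z. exp (\<alpha> * (norm (snd z) + c)))"
  proof (rule integrable_wrt_initial_law[where c = "exp (\<alpha> * c)"])
    show "(\<lambda>z::(real^'d) \<times> (real^'d). exp (\<alpha> * (norm (snd z) + c))) \<in> borel_measurable borel"
      by (intro borel_measurable_continuous_onI continuous_intros)
    fix z :: "(real^'d) \<times> (real^'d)"
    have "exp (\<alpha> * (norm (snd z) + c)) = exp (\<alpha> * c) * exp (\<alpha> * norm (snd z))"
      by (simp add: algebra_simps flip: exp_add)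
    also have "\<dots> \<le> exp (\<alpha> * c) * (norm (fst z) powr q + norm (snd z) powr q + exp (\<alpha> * norm (snd z)))"
      by (intro mult_left_mono) auto
    finally show "\<bar>exp (\<alpha> * (norm (snd z) + c))\<bar>
        \<le> exp (\<alpha> * c) * (norm (fst z) powr q + norm (snd z) powr q + exp (\<alpha> * norm (snd z)))" by simp
  qed
qed

text \<open>Transport identifies the kinetic force with the mean-field force of the flow over the initial
  law, and bounds the force in terms of the velocity and the first velocity moment
  \<open>m\<close>, which is bounded on \<open>{0..T}\<close>. In \<open>V \<bullet> V'\<close>
  the term \<open>- \<phi> (V \<bullet> V)\<close> is nonpositive and can be dropped, which leaves
  a growth of the norm of \<open>V\<close> that is additive and not multiplicative; an exponential
  moment therefore keeps its order.\<close>
lemma kinetic_flow: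
  assumes T: "T > 0"
  obtains \<Phi> c where "mean_field_flow \<kappa> \<phi> T initial_law \<Phi>"
    "\<And>t. t \<ge> 0 \<Longrightarrow> density lborel (\<lambda>z. ennreal (f t z)) = distr initial_law borel (\<Phi> t)"
    "\<And>z t. t \<in> {0..T} \<Longrightarrow> norm (snd (\<Phi> t z)) \<le> norm (snd z) + c"
proof -
  interpret prob_space initial_law by (rule prob_space_density_lborel[OF f0])
  from sol obtain \<Phi> where flow: "CS_flow \<kappa> \<phi> f \<Phi>"
    and Phim: "\<And>t. t \<ge> 0 \<Longrightarrow> \<Phi> t \<in> borel_measurable borel"
    and push: "\<And>t. t \<ge> 0 \<Longrightarrow> density lborel (\<lambda>z. ennreal (f t z)) = distr initial_law borel (\<Phi> t)"
    unfolding CS_weak_solution_def by blast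
  define X where "X t z = fst (\<Phi> t z)" for t z
  define V where "V t z = snd (\<Phi> t z)" for t z
  have Phim': "\<Phi> t \<in> measurable initial_law borel" if "t \<ge> 0" for t
    using Phim[OF that] by (simp add: measurable_cong_sets[OF sets_density refl])
  have Xm: "X t \<in> borel_measurable borel" and Vm: "V t \<in> borel_measurable borel" if "t \<ge> 0" for t
    unfolding X_def[abs_def] V_def[abs_def]
    by (rule measurable_compose[OF Phim[OF that] proj_measurable(3)],
        rule measurable_compose[OF Phim[OF that] proj_measurable(4)])
  have Xm': "X t \<in> borel_measurable initial_law" if "t \<ge> 0" for t
    using Xm[OF that] by (simp add: measurable_cong_sets[OF sets_density refl])
  have ft: "integrable lborel (f t)" "integrable lborel (\<lambda>w. (norm w)\<^sup>2 * f t w)" if "t \<ge> 0" for t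
    using sol that unfolding CS_weak_solution_def CS_solution_class_def
    by (auto dest!: spec[of _ "t + 1"])
  have ft0: "AE w in lborel. 0 \<le> f t w" if t: "t \<ge> 0" for t
  proof (rule AE_nonneg_of_equal_mass[OF ft(1)[OF t]])
    have 1: "(LINT w|lborel. f t w) = 1" using sol t f0(3) by (simp add: CS_weak_solution_def)
    have "(\<integral>\<^sup>+w. ennreal (f t w) \<partial>lborel) = emeasure (density lborel (\<lambda>z. ennreal (f t z))) UNIV"
      using borel_measurable_integrable[OF ft(1)[OF t]] by (subst emeasure_density) auto
    also have "\<dots> = emeasure (distr initial_law borel (\<Phi> t)) UNIV" by (simp only: push[OF t])
    also have "\<dots> = 1"
      using emeasure_space_1 by (subst emeasure_distr[OF Phim'[OF t]]) auto
    finally show "(\<integral>\<^sup>+w. ennreal (f t w) \<partial>lborel) = ennreal (LINT w|lborel. f t w)" using 1 by simp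
    show "0 \<le> (LINT w|lborel. f t w)" using 1 by simp
  qed
  have Vint: "integrable initial_law (V t)" if t: "t \<ge> 0" for t
  proof -
    have "integrable lborel (\<lambda>w. f t w *\<^sub>R snd w)"
    proof (rule Bochner_Integration.integrable_bound)
      show "integrable lborel (\<lambda>w. \<bar>f t w\<bar> + \<bar>(norm w)\<^sup>2 * f t w\<bar>)"
        using ft[OF t] by auto
      show "(\<lambda>w. f t w *\<^sub>R snd w) \<in> borel_measurable lborel"
        using borel_measurable_integrable[OF ft(1)[OF t]] proj_measurable(4)
        by (intro borel_measurable_scaleR) auto
      show "AE w in lborel. norm (f t w *\<^sub>R snd w) \<le> norm (\<bar>f t w\<bar> + \<bar>(norm w)\<^sup>2 * f t w\<bar>)"
      proof (rule AE_I2)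
        fix w :: "(real^'d) \<times> (real^'d)"
        have "norm (snd w) \<le> norm w" by (cases w) (simp add: norm_snd_le)
        moreover have "2 * norm w \<le> 1 + (norm w)\<^sup>2"
          using zero_le_power2[of "norm w - 1"] by (simp add: power2_diff)
        then have "norm w \<le> 1 + (norm w)\<^sup>2" using norm_ge_zero[of w] by linarith
        ultimately have "\<bar>f t w\<bar> * norm (snd w) \<le> \<bar>f t w\<bar> * (1 + (norm w)\<^sup>2)"
          by (intro mult_left_mono) auto
        then show "norm (f t w *\<^sub>R snd w) \<le> norm (\<bar>f t w\<bar> + \<bar>(norm w)\<^sup>2 * f t w\<bar>)"
          by (simp add: abs_mult algebra_simps)
      qed
    qed
    then have "integrable (density lborel (\<lambda>z. ennreal (f t z))) snd"
      using borel_measurable_integrable[OF ft(1)[OF t]] proj_measurable(4) ft0[OF t]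
      by (subst integrable_density) auto
    then have "integrable (distr initial_law borel (\<Phi> t)) snd" by (simp only: push[OF t])
    from integrable_distr[OF Phim'[OF t] this] show ?thesis by (simp add: V_def[abs_def])
  qed
  define F where "F t z = mean_field_force \<kappa> \<phi> initial_law (X t) (V t) z" for t z
  have force: "CS_force \<kappa> \<phi> (f t) (fst (\<Phi> t z)) (snd (\<Phi> t z)) = F t z" if t: "t \<ge> 0" for t z
  proof -
    define h where "h w = \<phi> (norm (fst (\<Phi> t z) - fst w)) *\<^sub>R (snd w - snd (\<Phi> t z))" for w
    have hm: "h \<in> borel_measurable borel"
      unfolding h_def[abs_def] using proj_measurable
      by (intro borel_measurable_scaleR borel_measurable_diff kernel_measurable[OF phi lip K L kappa]) auto
    have "F t z = \<kappa> *\<^sub>R (LINT z'|initial_law. h (\<Phi> t z'))"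
      by (simp add: F_def mean_field_force_def h_def X_def V_def)
    also have "(LINT z'|initial_law. h (\<Phi> t z')) = (LINT w|density lborel (\<lambda>z. ennreal (f t z)). h w)"
      unfolding push[OF t] by (rule integral_distr[OF Phim'[OF t] hm, symmetric])
    also have "\<dots> = (LINT w|lborel. f t w *\<^sub>R h w)"
      using hm borel_measurable_integrable[OF ft(1)[OF t]] ft0[OF t] by (intro integral_density) auto
    also have "\<kappa> *\<^sub>R \<dots> = (- \<kappa>) *\<^sub>R (LINT w|lborel. - (f t w *\<^sub>R h w))" by simp
    also have "(\<lambda>w. - (f t w *\<^sub>R h w))
        = (\<lambda>w. (\<phi> (norm (fst (\<Phi> t z) - fst w)) * f t w) *\<^sub>R (snd (\<Phi> t z) - snd w))"
      by (simp add: h_def fun_eq_iff mult.commute flip: scaleR_minus_right)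
    finally show ?thesis by (simp add: CS_force_def)
  qed
  have dX: "((\<lambda>s. X s z) has_vector_derivative V t z) (at t within {0..})"
    and dV: "((\<lambda>s. V s z) has_vector_derivative F t z) (at t within {0..})" if t: "t \<ge> 0" for t z
  proof -
    have "((\<lambda>s. \<Phi> s z) has_vector_derivative (V t z, F t z)) (at t within {0..})"
      using flow t unfolding V_def force[OF t, symmetric] CS_flow_def by blast
    from bounded_linear.has_vector_derivative[OF bounded_linear_fst this]
      bounded_linear.has_vector_derivative[OF bounded_linear_snd this]
    show "((\<lambda>s. X s z) has_vector_derivative V t z) (at t within {0..})"
      "((\<lambda>s. V s z) has_vector_derivative F t z) (at t within {0..})" by (simp_all add: X_def V_def)
  qed
  have dXT: "((\<lambda>s. X s z) has_vector_derivative V t z) (at t within {0..T})"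
    and dVT: "((\<lambda>s. V s z) has_vector_derivative F t z) (at t within {0..T})" if t: "t \<in> {0..T}" for t z
    using t by (auto intro: has_vector_derivative_within_subset[OF dX] has_vector_derivative_within_subset[OF dV])
  define m where "m t = (\<integral>z. norm (V t z) \<partial>initial_law)" for t
  have nV: "integrable initial_law (\<lambda>z. norm (V t z))" if "t \<ge> 0" for t using Vint[OF that] by simp
  have intA: "integrable initial_law (\<lambda>z'. \<phi> (norm (X t z - X t z')) *\<^sub>R (V t z' - V t z))" if t: "t \<ge> 0" for t z
    by (rule alignment_integrable[OF phi lip K L kappa prob_space_axioms Xm'[OF t] Vint[OF t]])
  have Fbound: "norm (F t z) \<le> (\<kappa> * K) * (m t + norm (V t z))" if t: "t \<ge> 0" for t z
  proof -
    have "norm (F t z) \<le> \<kappa> * (\<integral>z'. norm (\<phi> (norm (X t z - X t z')) *\<^sub>R (V t z' - V t z)) \<partial>initial_law)"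
      using mult_left_mono[OF integral_norm_bound less_imp_le[OF kappa]] kappa
      unfolding F_def mean_field_force_def norm_scaleR[of \<kappa>] abs_of_pos[OF kappa] by blast
    also have "\<dots> \<le> \<kappa> * (\<integral>z'. K * (norm (V t z') + norm (V t z)) \<partial>initial_law)"
    proof (intro mult_left_mono integral_mono)
      fix z'
      show "norm (\<phi> (norm (X t z - X t z')) *\<^sub>R (V t z' - V t z)) \<le> K * (norm (V t z') + norm (V t z))"
        unfolding norm_scaleR using phi[of "norm (X t z - X t z')"] K
        by (intro mult_mono norm_triangle_ineq4) auto
    qed (use kappa integrable_norm[OF intA[OF t, of z]] nV[OF t] in auto)
    also have "\<dots> = (\<kappa> * K) * (m t + norm (V t z))"
      using nV[OF t] prob_space by (simp add: m_def)
    finally show ?thesis .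
  qed
  have "\<exists>B. \<forall>t\<in>{0..T}. m t \<le> B"
    unfolding m_def
    by (rule first_moment_bounded_on_interval[OF prob_space_axioms mult_pos_pos[OF kappa K] Vint dV Fbound[unfolded m_def]])
       (use T in auto)
  then obtain B' where B': "\<And>t. t \<in> {0..T} \<Longrightarrow> m t \<le> B'" by blast
  define B where "B = max 0 B'"
  have B: "0 \<le> B" "\<And>t. t \<in> {0..T} \<Longrightarrow> m t \<le> B" using B' by (auto simp: B_def max.coboundedI2)
  define c where "c = \<kappa> * K * B * T"
  have c: "0 \<le> c" using kappa K B T by (simp add: c_def)
  have Vb: "norm (V t z) \<le> norm (snd z) + c" if t: "t \<in> {0..T}" for t z
  proof -
    have "norm (V t z) \<le> norm (snd z) + (\<kappa> * K * B) * t"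
    proof (rule norm_le_by_comparison[where w = "\<lambda>s. V s z" and w' = "\<lambda>s. F s z" and t = t and T = T
          and y = "\<lambda>s. norm (snd z) + (\<kappa> * K * B) * s" and y' = "\<lambda>_. \<kappa> * K * B"
          and b = "\<lambda>_. 0" and B = "\<lambda>_. 0" and g = "\<lambda>_. \<kappa> * K * B"])
      fix s assume s: "s \<in> {0..T}"
      then have s0: "s \<ge> 0" by simp
      have "V s z \<bullet> F s z = \<kappa> * (\<integral>z'. V s z \<bullet> (\<phi> (norm (X s z - X s z')) *\<^sub>R (V s z' - V s z)) \<partial>initial_law)"
        by (simp only: F_def mean_field_force_def inner_scaleR_right[of _ \<kappa>] integral_inner_right[OF intA[OF s0, of z]])
      also have "\<dots> \<le> \<kappa> * (\<integral>z'. K * norm (V s z) * norm (V s z') \<partial>initial_law)"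
      proof (intro mult_left_mono integral_mono)
        fix z'
        have p: "0 \<le> \<phi> (norm (X s z - X s z'))" "\<phi> (norm (X s z - X s z')) \<le> K" using phi by auto
        have "V s z \<bullet> (V s z' - V s z) \<le> norm (V s z) * norm (V s z')"
          using norm_cauchy_schwarz[of "V s z" "V s z'"] inner_ge_zero[of "V s z"]
          unfolding inner_diff_right by linarith
        then have "V s z \<bullet> (\<phi> (norm (X s z - X s z')) *\<^sub>R (V s z' - V s z))
            \<le> \<phi> (norm (X s z - X s z')) * (norm (V s z) * norm (V s z'))"
          using p by (simp add: mult_left_mono)
        also have "\<dots> \<le> K * (norm (V s z) * norm (V s z'))" using p by (intro mult_right_mono) auto
        finally show "V s z \<bullet> (\<phi> (norm (X s z - X s z')) *\<^sub>R (V s z' - V s z)) \<le> K * norm (V s z) * norm (V s z')"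
          by simp
      qed (use kappa integrable_inner_right[OF intA[OF s0, of z], of "V s z"] nV[OF s0] in auto)
      also have "\<dots> = norm (V s z) * (\<kappa> * K * m s)" by (simp add: m_def)
      also have "\<dots> \<le> norm (V s z) * (0 * norm (V s z) + \<kappa> * K * B)"
        using B(2)[OF s] kappa K by (simp add: mult_left_mono)
      finally show "V s z \<bullet> F s z \<le> norm (V s z) * (0 * norm (V s z) + \<kappa> * K * B)" .
    next
      have "\<Phi> 0 z = z" using flow unfolding CS_flow_def by blast
      then show "norm (V 0 z) \<le> norm (snd z) + \<kappa> * K * B * 0" by (simp add: V_def)
    qed (use t dVT kappa K B in \<open>auto intro!: derivative_eq_intros\<close>)
    also have "(\<kappa> * K * B) * t \<le> c"
      unfolding c_def using t kappa K B by (intro mult_left_mono) auto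
    finally show ?thesis by simp
  qed
  have Pb: "norm (\<Phi> t z) \<le> norm (fst z) + (T + 1) * (norm (snd z) + c)" if t: "t \<in> {0..T}" for t z
  proof -
    have "norm (X t z - X 0 z) \<le> (norm (snd z) + c) * \<bar>t - 0\<bar>"
      by (rule norm_increment_le[where f = "\<lambda>s. X s z" and f' = "\<lambda>s. V s z" and a = 0 and b = T])
         (use dXT Vb t in auto)
    also have "\<dots> \<le> (norm (snd z) + c) * T" using t c by (intro mult_left_mono) auto
    finally have "norm (X t z) \<le> norm (X 0 z) + (norm (snd z) + c) * T"
      using norm_triangle_sub[of "X t z" "X 0 z"] by linarith
    moreover have "X 0 z = fst z" using flow unfolding CS_flow_def X_def by metis
    moreover have "norm (\<Phi> t z) \<le> norm (X t z) + norm (V t z)"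
      using norm_Pair_le[of "X t z" "V t z"] by (simp add: X_def V_def)
    ultimately show ?thesis using Vb[OF t, of z] by (simp add: algebra_simps)
  qed
  show ?thesis
  proof (rule that)
    show "mean_field_flow \<kappa> \<phi> T initial_law \<Phi>"
      unfolding mean_field_flow_def
    proof (intro conjI ballI AE_I2)
      show "\<Phi> t \<in> borel_measurable borel" if "t \<in> {0..T}" for t using Phim that by simp
      show "\<Phi> 0 z = z" for z using flow unfolding CS_flow_def by blast
      show "((\<lambda>t. fst (\<Phi> t z)) has_vector_derivative snd (\<Phi> t z)) (at t within {0..T})" if "t \<in> {0..T}" for t z
        using dXT[OF that] by (simp add: X_def V_def)
      show "((\<lambda>t. snd (\<Phi> t z)) has_vector_derivative
        mean_field_force \<kappa> \<phi> initial_law (\<lambda>z. fst (\<Phi> t z)) (\<lambda>z. snd (\<Phi> t z)) z) (at t within {0..T})" if "t \<in> {0..T}" for t z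
        using dVT[OF that] by (simp add: X_def[abs_def] V_def[abs_def] F_def)
      show "\<exists>G. integrable initial_law G \<and> (AE z in initial_law. \<forall>t\<in>{0..T}. norm (\<Phi> t z) \<le> G z)"
        using Pb initial_moments by (intro exI[of _ "\<lambda>z. norm (fst z) + (T + 1) * (norm (snd z) + c)"]) auto
    qed
  qed (use push Vb in \<open>simp_all add: V_def\<close>)
qed

end

section \<open>Mean-field limit\<close>

theorem theorem3p2:
  fixes \<kappa> :: real
    and \<phi> :: "real \<Rightarrow> real"
    and f0 :: "(real^'d) \<times> (real^'d) \<Rightarrow> real"
    and f :: "real \<Rightarrow> (real^'d) \<times> (real^'d) \<Rightarrow> real"
    and M :: "'w measure"
    and Z :: "nat \<Rightarrow> nat \<Rightarrow> 'w \<Rightarrow> (real^'d) \<times> (real^'d)"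
    and x v :: "nat \<Rightarrow> 'w \<Rightarrow> nat \<Rightarrow> real \<Rightarrow> real^'d"
    and \<alpha> q C \<eta> :: real
  assumes "\<kappa> > 0"
    and "W1inf_half_line \<phi>"
    and "\<forall>r\<ge>0. 0 \<le> \<phi> r \<and>
           ereal (\<phi> r) \<le> esssup (restrict_space lborel {0..}) (\<lambda>s. ereal \<bar>\<phi> s\<bar>)"
    and "integrable lborel f0"
    and "Linf lborel f0"
    and "AE z in lborel. 0 \<le> f0 z"
    and "(LINT z|lborel. f0 z) = 1"
    and "prob_space M"
    and "\<alpha> > 0" and "q > 2"
    and "integrable lborel
           (\<lambda>z. (norm (fst z) powr q + norm (snd z) powr q + exp (\<alpha> * norm (snd z))) * f0 z)"
    and "\<forall>N\<ge>1. prob_space.indep_vars M (\<lambda>_. borel) (Z N) {1..N}"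
    and "\<forall>N\<ge>1. \<forall>i\<in>{1..N}. distr M borel (Z N i) = density lborel (\<lambda>z. ennreal (f0 z))"
    and "\<eta> > 0"
    and "\<forall>N\<ge>1. (\<integral>\<^sup>+ \<omega>. W1 (empirical N (\<lambda>i. Z N i \<omega>)) (density lborel (\<lambda>z. ennreal (f0 z))) \<partial>M)
           \<le> ennreal (C * real N powr (- \<eta>))"
    and "CS_weak_solution \<kappa> \<phi> f0 f"
    and "\<forall>N\<ge>1. \<forall>\<omega>\<in>space M. CS_particles \<kappa> \<phi> N (\<lambda>i. Z N i \<omega>) (x N \<omega>) (v N \<omega>)"
  shows "\<forall>T>0. \<exists>C_T>0. \<exists>\<eta>_T>0. \<forall>N\<ge>1.
           (\<integral>\<^sup>+ \<omega>. (SUP t\<in>{0..T}. W1 (empirical N (\<lambda>i. (x N \<omega> i t, v N \<omega> i t)))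
                                       (density lborel (\<lambda>z. ennreal (f t z)))) \<partial>M)
             \<le> ennreal (C_T / real N powr \<eta>_T)"
proof (intro allI impI)
  fix T :: real assume T: "T > 0"
  note kappa = assms(1) and alpha = assms(9) and eta = assms(14)
  have ess: "Linf (restrict_space lborel {0..}) \<phi>"
    using assms(2) by (auto simp: W1inf_half_line_def)
  obtain K where K1: "K \<ge> 1" and phi: "\<And>r. r \<ge> 0 \<Longrightarrow> 0 \<le> \<phi> r \<and> \<phi> r \<le> K"
    using kernel_bounded_of_esssup_bound[OF ess assms(3)] by blast
  have K: "K > 0" using K1 by simp
  obtain L where L: "L > 0" and lip: "\<And>r s. r \<ge> 0 \<Longrightarrow> s \<ge> 0 \<Longrightarrow> \<bar>\<phi> r - \<phi> s\<bar> \<le> L * \<bar>r - s\<bar>"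
    using W1inf_half_line_lipschitz[OF assms(2)] by blast
  define \<nu> where "\<nu> = density lborel (\<lambda>z. ennreal (f0 z))"
  note kin = phi lip K L kappa assms(4,6,7) alpha assms(10,11,16)
  obtain \<Phi> c where flow: "mean_field_flow \<kappa> \<phi> T \<nu> \<Phi>"
    and push: "\<And>t. t \<ge> 0 \<Longrightarrow> density lborel (\<lambda>z. ennreal (f t z)) = distr \<nu> borel (\<Phi> t)"
    and vel: "\<And>z t. t \<in> {0..T} \<Longrightarrow> norm (snd (\<Phi> t z)) \<le> norm (snd z) + c"
  proof (rule kinetic_flow[OF kin T, folded \<nu>_def])
    fix \<Phi> c assume "mean_field_flow \<kappa> \<phi> T \<nu> \<Phi>"
      "\<And>t. t \<ge> 0 \<Longrightarrow> density lborel (\<lambda>z. ennreal (f t z)) = distr \<nu> borel (\<Phi> t)"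
      "\<And>z t. t \<in> {0..T} \<Longrightarrow> norm (snd (\<Phi> t z)) \<le> norm (snd z) + c"
    then show thesis by (rule that)
  qed
  define W where "W z = norm (snd z) + c" for z :: "(real^'d) \<times> (real^'d)"
  have Wint: "integrable \<nu> (\<lambda>z. exp (\<alpha> * W z))"
    unfolding \<nu>_def W_def by (rule initial_moments(3)[OF kin])
  define E where "E = (\<integral>z. exp (\<alpha> * W z) \<partial>\<nu>)"
  have E: "0 \<le> E" unfolding E_def by (intro integral_nonneg_AE) auto
  have nu: "prob_space \<nu>" "sets \<nu> = sets borel"
    unfolding \<nu>_def using prob_space_density_lborel[OF assms(4,6,7)] by simp_all
  define lam where "lam = 12 * \<kappa> * L / \<alpha>"
  define c1 where "c1 = exp ((1 + 3 * \<kappa> * K) * T)"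
  define c2 where "c2 = (T + 1) * (2 * \<kappa> * K * E / \<alpha>)"
  define \<eta>_T where "\<eta>_T = \<eta> / 2 * exp (- lam * T)"
  \<comment> \<open>The summand 1 makes \<open>C_T\<close> positive also when the other terms
      vanish.\<close>
  define C_T where "C_T = 2 * c1 * (\<bar>C\<bar> + c2) + 1"
  have lam: "lam > 0" using kappa L alpha by (simp add: lam_def)
  have c: "c1 > 0" "c2 \<ge> 0" using T kappa K alpha E by (simp_all add: c1_def c2_def)
  have etaT: "\<eta>_T > 0" "\<eta>_T \<le> \<eta> / 2"
    using eta lam T by (simp_all add: \<eta>_T_def mult_left_le)
  have CT: "C_T > 0" unfolding C_T_def using c by (intro add_nonneg_pos mult_nonneg_nonneg) auto
  have main: "(\<integral>\<^sup>+ \<omega>. (SUP t\<in>{0..T}. W1 (empirical N (\<lambda>i. (x N \<omega> i t, v N \<omega> i t)))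
                                       (density lborel (\<lambda>z. ennreal (f t z)))) \<partial>M)
             \<le> ennreal (C_T / real N powr \<eta>_T)" if N: "N \<ge> 1" for N
  proof -
    \<comment> \<open>Chosen so that \<open>exp (\<alpha> R0) = N powr \<eta>\<close>.\<close>
    define R0 where "R0 = \<eta> / \<alpha> * ln (real N)"
    have R0: "R0 \<ge> 0" using N eta alpha by (simp add: R0_def)
    define A where "A = 2 * c1 * exp (\<alpha> / 2 * R0)"
    define B where "B = 2 * c1 * (c2 * exp (- (\<alpha> / 2) * R0 * exp (- lam * T)))"
    have AB: "A > 0" "B \<ge> 0" using c by (simp_all add: A_def B_def)
    have pA: "exp (\<alpha> / 2 * R0) = real N powr (\<eta> / 2)"
      using N alpha by (simp add: powr_def R0_def)
    have pB: "exp (- (\<alpha> / 2) * R0 * exp (- lam * T)) = real N powr (- \<eta>_T)"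
      using N alpha by (simp add: powr_def R0_def \<eta>_T_def)
    have path: "(SUP t\<in>{0..T}. W1 (empirical N (\<lambda>i. (x N \<omega> i t, v N \<omega> i t))) (density lborel (\<lambda>z. ennreal (f t z))))
        \<le> ennreal A * W1 (empirical N (\<lambda>i. Z N i \<omega>)) \<nu> + ennreal B" if w: "\<omega> \<in> space M" for \<omega>
    proof (rule SUP_least)
      fix t assume t: "t \<in> {0..T}"
      then have t0: "t \<ge> 0" by simp
      have part: "CS_particles \<kappa> \<phi> N (\<lambda>i. Z N i \<omega>) (x N \<omega>) (v N \<omega>)" using assms(17) N w by blast
      note P = phi lip K L kappa N part
      have emp: "distr (empirical N (\<lambda>i. Z N i \<omega>)) borel (particle_flow N (\<lambda>i. Z N i \<omega>) (x N \<omega>) (v N \<omega>) t)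
          = empirical N (\<lambda>i. (x N \<omega> i t, v N \<omega> i t))"
        by (rule distr_particle_flow[OF P t0])
      show "W1 (empirical N (\<lambda>i. (x N \<omega> i t, v N \<omega> i t))) (density lborel (\<lambda>z. ennreal (f t z)))
          \<le> ennreal A * W1 (empirical N (\<lambda>i. Z N i \<omega>)) \<nu> + ennreal B"
        unfolding push[OF t0] emp[symmetric]
          A_def B_def c1_def c2_def E_def lam_def
        by (rule mean_field_flow_W1_stability[OF phi lip K L kappa alpha R0 T prob_space_empirical[OF N] nu(1)
              sets_empirical nu(2) mean_field_flow_particles[OF P] flow _ Wint t])
           (use vel in \<open>simp_all add: W_def\<close>)
    qed
    have "(\<integral>\<^sup>+ \<omega>. (SUP t\<in>{0..T}. W1 (empirical N (\<lambda>i. (x N \<omega> i t, v N \<omega> i t)))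
                                       (density lborel (\<lambda>z. ennreal (f t z)))) \<partial>M)
        \<le> (\<integral>\<^sup>+ \<omega>. ennreal A * W1 (empirical N (\<lambda>i. Z N i \<omega>)) \<nu> + ennreal B \<partial>M)"
      by (rule nn_integral_mono[OF path])
    also have "\<dots> \<le> ennreal A * (\<integral>\<^sup>+ \<omega>. W1 (empirical N (\<lambda>i. Z N i \<omega>)) \<nu> \<partial>M) + ennreal B"
      by (rule nn_integral_affine_le[OF assms(8) AB])
    also have "\<dots> \<le> ennreal A * ennreal (\<bar>C\<bar> * real N powr (- \<eta>)) + ennreal B"
    proof (intro add_mono mult_left_mono order_refl)
      have "(\<integral>\<^sup>+ \<omega>. W1 (empirical N (\<lambda>i. Z N i \<omega>)) \<nu> \<partial>M) \<le> ennreal (C * real N powr (- \<eta>))"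
        unfolding \<nu>_def using assms(15) N by blast
      also have "\<dots> \<le> ennreal (\<bar>C\<bar> * real N powr (- \<eta>))" by (intro ennreal_leI mult_right_mono) auto
      finally show "(\<integral>\<^sup>+ \<omega>. W1 (empirical N (\<lambda>i. Z N i \<omega>)) \<nu> \<partial>M) \<le> ennreal (\<bar>C\<bar> * real N powr (- \<eta>))" .
    qed simp
    also have "\<dots> = ennreal (A * (\<bar>C\<bar> * real N powr (- \<eta>)) + B)"
      using AB by (simp add: ennreal_mult ennreal_plus)
    also have "\<dots> \<le> ennreal (C_T / real N powr \<eta>_T)"
    proof (rule ennreal_leI)
      have "A * (\<bar>C\<bar> * real N powr (- \<eta>)) = 2 * c1 * \<bar>C\<bar> * (real N powr (\<eta> / 2) * real N powr (- \<eta>))"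
        unfolding A_def pA by (simp only: mult_ac)
      also have "real N powr (\<eta> / 2) * real N powr (- \<eta>) = real N powr (- (\<eta> / 2))"
        by (simp flip: powr_add)
      also have "2 * c1 * \<bar>C\<bar> * real N powr (- (\<eta> / 2)) \<le> 2 * c1 * \<bar>C\<bar> * real N powr (- \<eta>_T)"
        using N c etaT by (intro mult_left_mono powr_mono) auto
      finally have "A * (\<bar>C\<bar> * real N powr (- \<eta>)) + B
          \<le> 2 * c1 * \<bar>C\<bar> * real N powr (- \<eta>_T) + 2 * c1 * (c2 * real N powr (- \<eta>_T))"
        unfolding B_def pB by simp
      also have "\<dots> \<le> C_T * real N powr (- \<eta>_T)"
        unfolding C_T_def by (simp add: algebra_simps)
      finally show "A * (\<bar>C\<bar> * real N powr (- \<eta>)) + B \<le> C_T / real N powr \<eta>_T"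
        by (simp add: powr_minus divide_inverse)
    qed
    finally show ?thesis .
  qed
  show "\<exists>C_T>0. \<exists>\<eta>_T>0. \<forall>N\<ge>1.
           (\<integral>\<^sup>+ \<omega>. (SUP t\<in>{0..T}. W1 (empirical N (\<lambda>i. (x N \<omega> i t, v N \<omega> i t)))
                                       (density lborel (\<lambda>z. ennreal (f t z)))) \<partial>M)
             \<le> ennreal (C_T / real N powr \<eta>_T)"
    using CT etaT(1) main by blast
qed

end
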